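(* In the setting of the context, let $\{w_k\}_{k\in\mathbb{N}}$ be a sequence of iterates generated by the extrapolation primal–dual interior-point method described in the context (run without stopping), and suppose there is a subsequence indexed by $\mathcal K$ with $w_{k+1}\to w^*$ as $k\in\mathcal K\to\infty$. Then the whole sequence $\{w_k\}$ converges to $w^*$; ultimately (for all $k$ sufficiently large) the inner minimization method is not needed, i.e. $\bar w_k$ itself satisfies $\|F^{\mu_k}(\bar w_k)\|\le\epsilon(\mu_k)$ and $w_{k+1}=\bar w_k$; the convergence is componentwise R-convergence of order $\kappa$; and for those components $j$ with $[\dot w^{w^*}(0)]_j\neq0$ the convergence is componentwise Q-convergence of order $\kappa$.
   Context: Problem: minimize $f(x)$ subject to $c_{\mathcal I}(x)\ge0$, $c_{\mathcal E}(x)=0$, with $f,c_i\colon\mathbb{R}^n\to\mathbb{R}$, $c=(c_{\mathcal I}^T,c_{\mathcal E}^T)^T\in\mathbb{R}^m$, and $d\ge3$ the smallest number of times each of $f,c_1,\dots,c_m$ is continuously differentiable. Notation: $g=\nabla f$, $A$ the Jacobian of $c$, $H(x,\lambda)$ the Hessian in $x$ of $f(x)-\lambda^Tc(x)$, $[v]_S$ components indexed by $S$, uppercase = diagonal matrix of the lowercase vector, $e$ all-ones vector, $w=(x,\lambda)$. $F^\mu(x,\lambda)=\bigl(g(x)-A(x)^T\lambda;\ C_{\mathcal I}(x)[\lambda]_{\mathcal I}-\mu e;\ c_{\mathcal E}(x)\bigr)$, with Jacobian $J_F$ in $w$. Let $x^*$ be a KKT point at which LICQ, strict complementarity (multiplier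 $\lambda^*$ with $[\lambda^*]_i>0$ for active inequality indices) and strong second-order sufficiency ($p^TH(x^*,\lambda^* )p\ge\omega\|p\|^2$, $\omega>0$, for all $p$ orthogonal to all active constraint gradients) hold; $\lambda^*$ unique; $w^*=(x^*,\lambda^* )$. Let $w^{w^*,0}$ be the locally unique $(d-1)$ times continuously differentiable function near $0$ with $F^0(w^{w^*,0}(r))=r$, $w^{w^*,0}(0)=w^*$; barrier trajectory $w^{w^*}(\mu)=w^{w^*,0}((0,\mu e^T,0)^T)$ and $\dot w^{w^*}$ its derivative in $\mu$. Extrapolated point: for $\mu>0$ and $w$ with $J_F(w)$ invertible, let $r=F^\mu(w)$, $\mathrm{nml}(r)=r/\|r\|$ ($r\ne0$), $\mathrm{nml}(0)=0$. There are unique vectors $v^{(1)},\dots,v^{(p)}$ such that the polynomial curve $P(\rho)=w+\sum_{q=1}^p v^{(q)}(\rho-\|r\|)^q/q!$ satisfies $F^\mu(P(\rho))=\rho\,\mathrm{nml}(r)+O(|\rho-\|r\|\,|^{p+1})$ (they are obtained recursively by differentiating $F^\mu(w(\rho))=\rho\,\mathrm{nml}(r)$ at $\rho=\|r\|$, each from a linear system with matrix $J_F(w)$); the $p$th-order extrapolation of $w$ for $\mu$ is $P(0)$. Algorithm: inputs $p\in\{1,\dots,d-2\}$, $\kappa\in(1,p+1)$, positive functions $\epsilon,\varphi$ with $\epsilon(\mu)=\Theta(\mu)$ and $\varphi(\mu)=\Theta(\mu^\kappa)$, a starting point $w_0\in\mathbb{R}^{n+m}$ and $\mu_0>0$. For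 $k=0,1,\dots$: if $J_F(w_k)$ is invertible, let $\bar w_k$ be the $p$th-order extrapolation of $w_k$ for $\mu_k$; otherwise $\bar w_k=w_k$. Then, if needed, apply an (unspecified) inner minimization method starting at $\bar w_k$ for the problem with complementarity perturbed by $\mu_k$ until a point $w_{k+1}$ with $\|F^{\mu_k}(w_{k+1})\|\le\epsilon(\mu_k)$ is found (if $\bar w_k$ already satisfies this, $w_{k+1}=\bar w_k$). Set $\mu_{k+1}=\varphi(\mu_k)$.
   Formalization: The formal theorem adds the hypothesis μ_k → 0; without it (e.g. φ(μ)=μ^κ, ε(μ)=μ, μ_0=1, so μ_k=1 for all k; f(x)=x, c(x)=x+9x²≥0, w_k=w* ) the inner method can be needed at every iteration and the claim fails. *)

theory Defs
  imports "HOL-Analysis.Analysis" "HOL-Library.Landau_Symbols"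
begin

fun Ck :: "nat \<Rightarrow> ('a::real_normed_vector \<Rightarrow> 'b::real_normed_vector) \<Rightarrow> bool" where
  "Ck 0 f = continuous_on UNIV f"
| "Ck (Suc k) f = (\<exists>f'. (\<forall>x. (f has_derivative f' x) (at x)) \<and> (\<forall>h. Ck k (\<lambda>x. f' x h)))"

definition grad :: "(real^'n \<Rightarrow> real) \<Rightarrow> real^'n \<Rightarrow> real^'n" where
  "grad \<phi> x = (\<chi> j. frechet_derivative \<phi> (at x) (axis j 1))"

definition jac :: "(real^'n \<Rightarrow> real^'m) \<Rightarrow> real^'n \<Rightarrow> real^'n^'m" where
  "jac c x = (\<chi> i. grad (\<lambda>y. c y $ i) x)"

definition hess :: "(real^'n \<Rightarrow> real) \<Rightarrow> real^'n \<Rightarrow> real^'n^'n" where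
  "hess \<phi> x = (\<chi> i. grad (\<lambda>y. grad \<phi> y $ i) x)"

definition lag_hess :: "(real^'n \<Rightarrow> real) \<Rightarrow> (real^'n \<Rightarrow> real^'m) \<Rightarrow> real^'n \<Rightarrow> real^'m \<Rightarrow> real^'n^'n" where
  "lag_hess f c x l = hess (\<lambda>y. f y - l \<bullet> c y) x"

text \<open>Inequality indices I; equality indices are the complement of I.\<close>
definition active :: "(real^'n \<Rightarrow> real^'m) \<Rightarrow> 'm set \<Rightarrow> real^'n \<Rightarrow> 'm set" where
  "active c I x = {i. i \<notin> I \<or> (i \<in> I \<and> c x $ i = 0)}"

definition is_KKT_mult :: "(real^'n \<Rightarrow> real) \<Rightarrow> (real^'n \<Rightarrow> real^'m) \<Rightarrow> 'm set \<Rightarrow> real^'n \<Rightarrow> real^'m \<Rightarrow> bool" where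
  "is_KKT_mult f c I x l \<longleftrightarrow>
     grad f x - transpose (jac c x) *v l = 0 \<and>
     (\<forall>i\<in>I. c x $ i \<ge> 0 \<and> l $ i \<ge> 0 \<and> l $ i * c x $ i = 0) \<and>
     (\<forall>i. i \<notin> I \<longrightarrow> c x $ i = 0)"

definition LICQ :: "(real^'n \<Rightarrow> real^'m) \<Rightarrow> 'm set \<Rightarrow> real^'n \<Rightarrow> bool" where
  "LICQ c I x \<longleftrightarrow> (\<forall>a. (\<Sum>i\<in>active c I x. a i *\<^sub>R row i (jac c x)) = 0
                        \<longrightarrow> (\<forall>i\<in>active c I x. a i = 0))"

definition strict_compl :: "(real^'n \<Rightarrow> real^'m) \<Rightarrow> 'm set \<Rightarrow> real^'n \<Rightarrow> real^'m \<Rightarrow> bool" where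
  "strict_compl c I x l \<longleftrightarrow> (\<forall>i\<in>I. c x $ i = 0 \<longrightarrow> l $ i > 0)"

definition SSOSC :: "(real^'n \<Rightarrow> real) \<Rightarrow> (real^'n \<Rightarrow> real^'m) \<Rightarrow> 'm set \<Rightarrow> real^'n \<Rightarrow> real^'m \<Rightarrow> bool" where
  "SSOSC f c I x l \<longleftrightarrow> (\<exists>\<omega>>0. \<forall>p. (\<forall>i\<in>active c I x. row i (jac c x) \<bullet> p = 0)
        \<longrightarrow> p \<bullet> (lag_hess f c x l *v p) \<ge> \<omega> * (norm p)\<^sup>2)"

definition Fmu :: "(real^'n \<Rightarrow> real) \<Rightarrow> (real^'n \<Rightarrow> real^'m) \<Rightarrow> 'm set \<Rightarrow> real
                    \<Rightarrow> (real^'n) \<times> (real^'m) \<Rightarrow> (real^'n) \<times> (real^'m)" where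
  "Fmu f c I \<mu> w = (case w of (x, l) \<Rightarrow>
     (grad f x - transpose (jac c x) *v l,
      \<chi> i. if i \<in> I then c x $ i * l $ i - \<mu> else c x $ i))"

text \<open>J_F(w) invertible: the derivative of F^mu at w (independent of mu) is bijective.\<close>
definition JF_invertible :: "(real^'n \<Rightarrow> real) \<Rightarrow> (real^'n \<Rightarrow> real^'m) \<Rightarrow> 'm set
                    \<Rightarrow> (real^'n) \<times> (real^'m) \<Rightarrow> bool" where
  "JF_invertible f c I w \<longleftrightarrow> (Fmu f c I 0 differentiable at w) \<and> bij (frechet_derivative (Fmu f c I 0) (at w))"

definition nml :: "'a::real_normed_vector \<Rightarrow> 'a" where
  "nml r = (if r = 0 then 0 else (1 / norm r) *\<^sub>R r)"

definition polycurve :: "'a::real_normed_vector \<Rightarrow> (nat \<Rightarrow> 'a) \<Rightarrow> nat \<Rightarrow> real \<Rightarrow> real \<Rightarrow> 'a" where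
  "polycurve w v p s \<rho> = w + (\<Sum>q=1..p. ((\<rho> - s) ^ q / fact q) *\<^sub>R v q)"

definition extrap :: "('a::real_normed_vector \<Rightarrow> 'a) \<Rightarrow> nat \<Rightarrow> 'a \<Rightarrow> 'a" where
  "extrap F p w = (let r = F w; s = norm r;
      v = (THE v. (\<forall>q. (q = 0 \<or> p < q) \<longrightarrow> v q = 0) \<and>
                  (\<lambda>\<rho>. norm (F (polycurve w v p s \<rho>) - \<rho> *\<^sub>R nml r)) \<in> O[at s](\<lambda>\<rho>. \<bar>\<rho> - s\<bar> ^ (p + 1)))
    in polycurve w v p s 0)"

definition wbar :: "(real^'n \<Rightarrow> real) \<Rightarrow> (real^'n \<Rightarrow> real^'m) \<Rightarrow> 'm set \<Rightarrow> nat
                    \<Rightarrow> real \<Rightarrow> (real^'n) \<times> (real^'m) \<Rightarrow> (real^'n) \<times> (real^'m)" where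
  "wbar f c I p \<mu> w = (if JF_invertible f c I w then extrap (Fmu f c I \<mu>) p w else w)"

text \<open>Iterates of the extrapolation method run without stopping; the inner
  minimization method is arbitrary, only its stopping test is modelled.\<close>
definition epd_iterates :: "(real^'n \<Rightarrow> real) \<Rightarrow> (real^'n \<Rightarrow> real^'m) \<Rightarrow> 'm set \<Rightarrow> nat
     \<Rightarrow> (real \<Rightarrow> real) \<Rightarrow> (real \<Rightarrow> real) \<Rightarrow> (nat \<Rightarrow> (real^'n) \<times> (real^'m)) \<Rightarrow> (nat \<Rightarrow> real) \<Rightarrow> bool" where
  "epd_iterates f c I p \<epsilon> \<phi> w \<mu> \<longleftrightarrow> \<mu> 0 > 0 \<and>
     (\<forall>k. \<mu> (Suc k) = \<phi> (\<mu> k) \<and>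
          (if norm (Fmu f c I (\<mu> k) (wbar f c I p (\<mu> k) (w k))) \<le> \<epsilon> (\<mu> k)
           then w (Suc k) = wbar f c I p (\<mu> k) (w k)
           else norm (Fmu f c I (\<mu> k) (w (Suc k))) \<le> \<epsilon> (\<mu> k)))"

definition rvec :: "'m set \<Rightarrow> real \<Rightarrow> (real^'n) \<times> (real^'m)" where
  "rvec I \<mu> = (0, \<chi> i. if i \<in> I then \<mu> else 0)"

definition traj_deriv0 :: "(real^'n \<Rightarrow> real) \<Rightarrow> (real^'n \<Rightarrow> real^'m) \<Rightarrow> 'm set
                    \<Rightarrow> (real^'n) \<times> (real^'m) \<Rightarrow> (real^'n) \<times> (real^'m)" where
  "traj_deriv0 f c I ws = (THE v. \<exists>G U. open U \<and> 0 \<in> U \<and> continuous_on U G \<and> G 0 = ws \<and>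
        (\<forall>r\<in>U. Fmu f c I 0 (G r) = r) \<and>
        ((\<lambda>\<mu>. G (rvec I \<mu>)) has_vector_derivative v) (at 0))"

definition R_conv_order :: "(nat \<Rightarrow> real) \<Rightarrow> real \<Rightarrow> real \<Rightarrow> bool" where
  "R_conv_order e l \<kappa> \<longleftrightarrow> e \<longlonglongrightarrow> l \<and>
     (\<exists>C \<theta>. 0 < \<theta> \<and> \<theta> < 1 \<and> (\<forall>\<^sub>F k in sequentially. \<bar>e k - l\<bar> \<le> C * \<theta> powr (\<kappa> ^ k)))"

definition Q_conv_order :: "(nat \<Rightarrow> real) \<Rightarrow> real \<Rightarrow> real \<Rightarrow> bool" where
  "Q_conv_order e l \<kappa> \<longleftrightarrow> e \<longlonglongrightarrow> l \<and>
     (\<exists>C. \<forall>\<^sub>F k in sequentially. \<bar>e (Suc k) - l\<bar> \<le> C * \<bar>e k - l\<bar> powr \<kappa>)"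

end

theory Submission
  imports Defs
begin

text \<open>
  At \<open>w\<^sup>*\<close> the Jacobian of \<open>F = F\<^sup>0\<close> is nonsingular, so \<open>F\<close> has a local inverse \<open>G\<close> of class
  \<open>C\<^sup>p\<^sup>+\<^sup>1\<close>. Near \<open>w\<^sup>*\<close> the polynomial curve of the extrapolation is the Taylor polynomial of order
  \<open>p\<close> of the curve \<open>\<rho> \<mapsto> G (\<mu> e + \<rho> nml r)\<close>; hence one extrapolation step turns a residual of size
  \<open>norm r\<close> into one of size \<open>O(norm r ^ (p + 1))\<close>, uniformly near \<open>w\<^sup>*\<close>. An iterate close to
  \<open>w\<^sup>*\<close> has residual \<open>O(\<mu>\<^sub>k\<^sub>-\<^sub>1)\<close> for the parameter \<open>\<mu>\<^sub>k\<close>, so the next residual is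
  \<open>O(\<mu>\<^sub>k\<^sub>-\<^sub>1 ^ (p + 1)) = o(\<mu>\<^sub>k)\<close> because \<open>\<kappa> < p + 1\<close>: the stopping test holds, the next iterate is
  again close to \<open>w\<^sup>*\<close>, and by induction the iterates stay there. Differentiating \<open>G\<close> at \<open>0\<close> gives
  \<open>(w\<^sub>k\<^sub>+\<^sub>1 - w\<^sup>*) / \<mu>\<^sub>k\<close> \<open>\<rightarrow>\<close> the derivative of the barrier trajectory, and both rates follow from
  \<open>\<mu>\<^sub>k\<^sub>+\<^sub>1 = \<Theta>(\<mu>\<^sub>k ^ \<kappa>)\<close>.
\<close>

section \<open>Functions of class \<open>C\<^sup>k\<close> on an open set\<close>

text \<open>Derivatives are required to be regular for one fixed direction \<open>h\<close> at a
  time. This avoids spaces of operators and, in finite dimension, gives the usual class. The set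
  \<open>U\<close> is there because the local inverse exists only near a point.\<close>

fun Ck_on :: "nat \<Rightarrow> 'a::real_normed_vector set \<Rightarrow> ('a \<Rightarrow> 'b::real_normed_vector) \<Rightarrow> bool" where
  "Ck_on 0 U f = continuous_on U f"
| "Ck_on (Suc k) U f =
     (\<exists>f'. (\<forall>x\<in>U. (f has_derivative f' x) (at x)) \<and> (\<forall>h. Ck_on k U (\<lambda>x. f' x h)))"

lemma Ck_iff_Ck_on: "Ck k f \<longleftrightarrow> Ck_on k UNIV f"
  by (induction k arbitrary: f) auto

lemma Ck_on_subset: "Ck_on k U f \<Longrightarrow> V \<subseteq> U \<Longrightarrow> Ck_on k V f"
  by (induction k arbitrary: f) (auto intro: continuous_on_subset, blast)

lemma Ck_on_SucD: "Ck_on (Suc k) U f \<Longrightarrow> Ck_on k U f"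
proof (induction k arbitrary: f)
  case 0
  then show ?case
    by (auto intro!: continuous_at_imp_continuous_on intro: has_derivative_continuous)
next
  case (Suc k)
  then show ?case
    by (metis Ck_on.simps(2))
qed

lemma Ck_on_mono: "Ck_on m U f \<Longrightarrow> k \<le> m \<Longrightarrow> Ck_on k U f"
  by (induction m) (auto simp: le_Suc_eq simp del: Ck_on.simps dest: Ck_on_SucD)

section \<open>Closure under the elementary operations\<close>

lemma Ck_on_const: "Ck_on k U (\<lambda>x. a)"
proof (induction k arbitrary: a)
  case (Suc k)
  have "\<forall>x\<in>U. ((\<lambda>x. a) has_derivative (\<lambda>h. 0)) (at x)" by simp
  then show ?case
    using Suc[of 0] unfolding Ck_on.simps by (intro exI[of _ "\<lambda>x h. 0"]) auto
qed auto

lemma Ck_on_bounded_linear: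
  assumes "bounded_linear L" and "Ck_on k U f"
  shows "Ck_on k U (\<lambda>x. L (f x))"
  using assms(2)
proof (induction k arbitrary: f)
  case 0
  then show ?case by (auto intro: bounded_linear.continuous_on[OF assms(1)])
next
  case (Suc k)
  then obtain f' where f': "\<forall>x\<in>U. (f has_derivative f' x) (at x)" "\<forall>h. Ck_on k U (\<lambda>x. f' x h)"
    by auto
  then show ?case
    unfolding Ck_on.simps
    by (intro exI[of _ "\<lambda>x h. L (f' x h)"])
      (auto intro!: bounded_linear.has_derivative[OF assms(1)] Suc.IH)
qed

lemma Ck_on_id: "Ck_on k U (\<lambda>x. x)"
proof (cases k)
  case (Suc m)
  then show ?thesis by (auto intro!: exI[of _ "\<lambda>x h. h"] Ck_on_const)
qed auto

lemma Ck_on_add: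
  "Ck_on k U f \<Longrightarrow> Ck_on k U g \<Longrightarrow> Ck_on k U (\<lambda>x. f x + g x)"
proof (induction k arbitrary: f g)
  case 0
  then show ?case by (auto intro: continuous_intros)
next
  case (Suc k)
  from Suc.prems obtain f' where
    f': "\<forall>x\<in>U. (f has_derivative f' x) (at x)" "\<forall>h. Ck_on k U (\<lambda>x. f' x h)" by auto
  from Suc.prems obtain g' where
    g': "\<forall>x\<in>U. (g has_derivative g' x) (at x)" "\<forall>h. Ck_on k U (\<lambda>x. g' x h)" by auto
  show ?case
    unfolding Ck_on.simps using f' g'
    by (intro exI[of _ "\<lambda>x h. f' x h + g' x h"]) (auto intro!: derivative_intros Suc.IH)
qed

lemma Ck_on_minus:
  assumes "Ck_on k U f" shows "Ck_on k U (\<lambda>x. - f x)"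
  using Ck_on_bounded_linear[OF bounded_linear_minus[OF bounded_linear_ident] assms] by simp

lemma Ck_on_diff:
  assumes "Ck_on k U f" and "Ck_on k U g" shows "Ck_on k U (\<lambda>x. f x - g x)"
  using Ck_on_add[OF assms(1) Ck_on_minus[OF assms(2)]] by simp

lemma Ck_on_sum:
  assumes "\<And>i. i \<in> S \<Longrightarrow> Ck_on k U (f i)"
  shows "Ck_on k U (\<lambda>x. \<Sum>i\<in>S. f i x)"
  using assms by (induction S rule: infinite_finite_induct) (auto intro: Ck_on_const Ck_on_add)

lemma Ck_on_bounded_bilinear:
  assumes "bounded_bilinear m"
  shows "Ck_on k U f \<Longrightarrow> Ck_on k U g \<Longrightarrow> Ck_on k U (\<lambda>x. m (f x) (g x))"
proof (induction k arbitrary: f g)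
  case 0
  then show ?case by (auto intro: bounded_bilinear.continuous_on[OF assms])
next
  case (Suc k)
  from Suc.prems obtain f' where
    f': "\<forall>x\<in>U. (f has_derivative f' x) (at x)" "\<forall>h. Ck_on k U (\<lambda>x. f' x h)" by auto
  from Suc.prems obtain g' where
    g': "\<forall>x\<in>U. (g has_derivative g' x) (at x)" "\<forall>h. Ck_on k U (\<lambda>x. g' x h)" by auto
  have "Ck_on k U f" "Ck_on k U g" using Suc.prems Ck_on_SucD by blast+
  then show ?case
    unfolding Ck_on.simps using f' g'
    by (intro exI[of _ "\<lambda>x h. m (f x) (g' x h) + m (f' x h) (g x)"])
      (auto intro!: Ck_on_add Suc.IH bounded_bilinear.FDERIV[OF assms])
qed

lemmas Ck_on_scaleR = Ck_on_bounded_bilinear[OF bounded_bilinear_scaleR]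
lemmas Ck_on_mult = Ck_on_bounded_bilinear[OF bounded_bilinear_mult]
lemmas Ck_on_inner_left = Ck_on_bounded_linear[OF bounded_linear_inner_left]

section \<open>Composition and inversion\<close>

lemma linear_basis_expansion:
  fixes L :: "'a::euclidean_space \<Rightarrow> 'b::real_vector"
  assumes "linear L"
  shows "L h = (\<Sum>b\<in>Basis. (h \<bullet> b) *\<^sub>R L b)"
proof -
  have "L h = L (\<Sum>b\<in>Basis. (h \<bullet> b) *\<^sub>R b)" by (simp add: euclidean_representation)
  also have "\<dots> = (\<Sum>b\<in>Basis. (h \<bullet> b) *\<^sub>R L b)"
    by (simp add: linear_sum[OF assms] linear_scale[OF assms])
  finally show ?thesis .
qed

text \<open>The chain rule produces \<open>f' (g x) (g' x h)\<close>, whose direction moves with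
  \<open>x\<close>, while the induction hypothesis covers only fixed directions. Expanding
  \<open>g' x h\<close> in the basis leaves products of scalar functions with
  \<open>f' (g x) b\<close> for fixed \<open>b\<close>, which are of class C^k.\<close>

lemma Ck_on_compose:
  fixes f :: "'b::euclidean_space \<Rightarrow> 'c::real_normed_vector"
  assumes "Ck_on k U f" and "Ck_on k V g" and "g ` V \<subseteq> U"
  shows "Ck_on k V (\<lambda>x. f (g x))"
  using assms
proof (induction k arbitrary: f)
  case 0
  then show ?case by (auto intro: continuous_on_compose2)
next
  case (Suc k)
  from Suc.prems obtain f' where
    f': "\<And>x. x\<in>U \<Longrightarrow> (f has_derivative f' x) (at x)" "\<And>h. Ck_on k U (\<lambda>x. f' x h)" by auto
  from Suc.prems(2) obtain g' where
    g': "\<And>x. x\<in>V \<Longrightarrow> (g has_derivative g' x) (at x)" "\<And>h. Ck_on k V (\<lambda>x. g' x h)" by auto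
  have gk: "Ck_on k V g" using Suc.prems Ck_on_SucD by blast
  have "((\<lambda>x. f (g x)) has_derivative (\<lambda>h. \<Sum>b\<in>Basis. (g' x h \<bullet> b) *\<^sub>R f' (g x) b)) (at x)"
    if "x \<in> V" for x
  proof -
    have "g x \<in> U" using that Suc.prems by auto
    then show ?thesis
      using has_derivative_compose[OF g'(1)[OF that] f'(1)]
      by (simp flip: linear_basis_expansion[OF has_derivative_linear[OF f'(1)]])
  qed
  moreover have "Ck_on k V (\<lambda>x. \<Sum>b\<in>Basis. (g' x h \<bullet> b) *\<^sub>R f' (g x) b)" for h
    using g'(2) gk f'(2) Suc.prems(3) by (intro Ck_on_sum Ck_on_scaleR Ck_on_inner_left Suc.IH)
  ultimately show ?case
    unfolding Ck_on.simps by (intro exI[of _ "\<lambda>x h. \<Sum>b\<in>Basis. (g' x h \<bullet> b) *\<^sub>R f' (g x) b"]) blast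
qed

text \<open>A product rule in which one factor is merely continuous: because \<open>u\<close>
  vanishes at \<open>x\<close>, the variation of \<open>v\<close> only enters multiplied by a term
  of first order. It serves to differentiate an inverse whose differentiability is not yet
  known.\<close>

lemma has_derivative_scaleR_zero:
  fixes u :: "'a::real_normed_vector \<Rightarrow> real" and v :: "'a \<Rightarrow> 'b::real_normed_vector"
  assumes u: "(u has_derivative u') (at x)" and "u x = 0" and v: "isCont v x"
  shows "((\<lambda>y. u y *\<^sub>R v y) has_derivative (\<lambda>h. u' h *\<^sub>R v x)) (at x)"
proof -
  interpret u': bounded_linear u' using u by (rule has_derivative_bounded_linear)
  obtain B where B: "\<And>h. norm (u' h) \<le> norm h * B" using u'.bounded by blast
  define q where "q y = (u y - u x - u' (y - x)) /\<^sub>R norm (y - x)" for y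
  have q: "(q \<longlongrightarrow> 0) (at x)"
    using u unfolding has_derivative_at_within q_def by simp
  have v0: "((\<lambda>y. v y - v x) \<longlongrightarrow> 0) (at x)"
    using v by (simp add: isCont_def LIM_zero)
  have vx: "(v \<longlongrightarrow> v x) (at x)" using v by (simp add: isCont_def)
  \<comment> \<open>The remainder quotient of the product splits into the remainder quotient of
    \<open>u\<close> times \<open>v\<close>, and a bounded factor times \<open>v y - v x\<close>;
    both tend to 0.\<close>
  define z where "z y = q y *\<^sub>R v y + (u' (y - x) / norm (y - x)) *\<^sub>R (v y - v x)" for y
  have "((\<lambda>y. (u' (y - x) / norm (y - x)) *\<^sub>R (v y - v x)) \<longlongrightarrow> 0) (at x)"
  proof (rule Lim_null_comparison[OF always_eventually])
    show "\<forall>y. norm ((u' (y - x) / norm (y - x)) *\<^sub>R (v y - v x)) \<le> \<bar>B\<bar> * norm (v y - v x)"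
    proof
      fix y
      have "\<bar>u' (y - x)\<bar> \<le> \<bar>B\<bar> * norm (y - x)"
        using B[of "y - x"] by (simp add: mult.commute order_trans[OF _ mult_right_mono[OF abs_ge_self]])
      then have "\<bar>u' (y - x) / norm (y - x)\<bar> \<le> \<bar>B\<bar>"
        by (cases "y = x") (auto simp: divide_le_eq abs_divide)
      then show "norm ((u' (y - x) / norm (y - x)) *\<^sub>R (v y - v x)) \<le> \<bar>B\<bar> * norm (v y - v x)"
        unfolding norm_scaleR by (intro mult_right_mono) auto
    qed
    show "((\<lambda>y. \<bar>B\<bar> * norm (v y - v x)) \<longlongrightarrow> 0) (at x)"
      by (intro tendsto_mult_right_zero tendsto_norm_zero v0)
  qed
  moreover have "((\<lambda>y. q y *\<^sub>R v y) \<longlongrightarrow> 0) (at x)" using tendsto_scaleR[OF q vx] by simp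
  ultimately have z: "(z \<longlongrightarrow> 0) (at x)" unfolding z_def using tendsto_add by fastforce
  have "(u y *\<^sub>R v y - u x *\<^sub>R v x - u' (y - x) *\<^sub>R v x) /\<^sub>R norm (y - x) = z y" for y
    using \<open>u x = 0\<close> by (simp add: z_def q_def algebra_simps divide_inverse)
  then have "((\<lambda>y. (u y *\<^sub>R v y - u x *\<^sub>R v x - u' (y - x) *\<^sub>R v x) /\<^sub>R norm (y - x)) \<longlongrightarrow> 0) (at x)"
    using z by simp
  moreover have "bounded_linear (\<lambda>h. u' h *\<^sub>R v x)"
    by (rule bounded_linear_compose[OF bounded_linear_scaleR_left u'.bounded_linear_axioms])
  ultimately show ?thesis by (simp add: has_derivative_at_within)
qed

text \<open>Continuity follows from M y - M x = - M y (A y - A x) M x once the norm of M y is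
  bounded near x. The bound comes from the usual perturbation argument: M y has norm at most twice
  the bound on M x when A y is close enough to A x.\<close>

lemma continuous_on_linear_inverse:
  fixes A M :: "'a::topological_space \<Rightarrow> 'b::euclidean_space \<Rightarrow> 'b"
  assumes linA: "\<And>x. x \<in> U \<Longrightarrow> linear (A x)" and linM: "\<And>x. x \<in> U \<Longrightarrow> linear (M x)"
    and MA: "\<And>x h. x \<in> U \<Longrightarrow> M x (A x h) = h" and AM: "\<And>x h. x \<in> U \<Longrightarrow> A x (M x h) = h"
    and cA: "\<And>h. continuous_on U (\<lambda>x. A x h)"
  shows "continuous_on U (\<lambda>x. M x h)"
proof (unfold continuous_on_def, intro ballI)
  fix x assume x: "x \<in> U"
  have bl: "bounded_linear (M x)" using linM[OF x] by (simp add: linear_conv_bounded_linear)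
  obtain B where B: "B > 0" "\<And>h. norm (M x h) \<le> norm h * B"
    using bounded_linear.pos_bounded[OF bl] by blast
  \<comment> \<open>\<open>S y\<close> dominates the operator norm of A y - A x, and being a finite
    sum over the basis it tends to 0 although continuity is known only for each fixed
    vector.\<close>
  define S where "S y = (\<Sum>b\<in>Basis. norm (A y b - A x b))" for y
  have S0: "(S \<longlongrightarrow> 0) (at x within U)"
    unfolding S_def using cA x
    by (intro tendsto_null_sum tendsto_norm_zero LIM_zero) (auto simp: continuous_on_def)
  have diff: "norm (A y z - A x z) \<le> norm z * S y" if "y \<in> U" for y z
  proof -
    have "A y z - A x z = (\<Sum>b\<in>Basis. (z \<bullet> b) *\<^sub>R (A y b - A x b))"
      using linear_basis_expansion[OF linA[OF that], of z] linear_basis_expansion[OF linA[OF x], of z]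
      by (simp add: scaleR_diff_right sum_subtractf)
    also have "norm \<dots> \<le> (\<Sum>b\<in>Basis. norm z * norm (A y b - A x b))"
      by (intro sum_norm_le) (auto intro!: mult_right_mono simp: Basis_le_norm)
    finally show ?thesis by (simp add: S_def sum_distrib_left)
  qed
  have "\<forall>\<^sub>F y in at x within U. S y < 1 / (2 * B)"
    using order_tendstoD(2)[OF S0] B(1) by simp
  moreover have "\<forall>\<^sub>F y in at x within U. y \<in> U" by (simp add: eventually_at_filter)
  ultimately have "\<forall>\<^sub>F y in at x within U. norm (M y h - M x h) \<le> 2 * B * norm (M x h) * S y"
  proof eventually_elim
    fix y assume S: "S y < 1 / (2 * B)" and y: "y \<in> U"
    \<comment> \<open>With v = A y z, the estimate norm z \<le> B norm (A x z) is compared with A y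
      z; the error B S(y) norm z is at most half of norm z and is absorbed on the left.\<close>
    have bnd: "norm (M y v) \<le> 2 * B * norm v" for v
    proof -
      define z where "z = M y v"
      have v: "v = A y z" by (simp add: z_def AM y)
      have S_nonneg: "S y \<ge> 0" by (simp add: S_def sum_nonneg)
      have "norm z = norm (M x (A x z))" using MA x by simp
      also have "\<dots> \<le> norm (A x z) * B" by (rule B)
      also have "\<dots> \<le> (norm (A y z) + norm z * S y) * B"
        using diff[OF y, of z] B(1) norm_triangle_sub[of "A x z" "A y z"]
        by (intro mult_right_mono) (auto simp: norm_minus_commute)
      also have "\<dots> \<le> norm v * B + norm z * (1/2)"
      proof -
        have "S y * B \<le> 1/2" using S B(1) by (simp add: field_simps)
        then have "norm z * (S y * B) \<le> norm z * (1/2)" by (rule mult_left_mono) simp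
        then show ?thesis by (simp add: v algebra_simps)
      qed
      finally show ?thesis by (simp add: z_def algebra_simps)
    qed
    have "M y h - M x h = - M y (A y (M x h) - A x (M x h))"
      using linM[OF y] by (simp add: linear_diff MA AM x y)
    then have "norm (M y h - M x h) \<le> 2 * B * norm (A y (M x h) - A x (M x h))"
      using bnd by simp
    also have "\<dots> \<le> 2 * B * (norm (M x h) * S y)"
      using diff[OF y] B(1) by (intro mult_left_mono) auto
    finally show "norm (M y h - M x h) \<le> 2 * B * norm (M x h) * S y" by (simp add: mult.assoc)
  qed
  then have "((\<lambda>y. M y h - M x h) \<longlongrightarrow> 0) (at x within U)"
    by (rule Lim_null_comparison) (intro tendsto_mult_right_zero S0)
  then show "((\<lambda>y. M y h) \<longlongrightarrow> M x h) (at x within U)" by (rule LIM_zero_cancel)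
qed

text \<open>The derivative of M is - M A' M, an expression in M itself and in derivatives of A. So
  if M is of class C^k and A of class C^(k+1), then M is of class C^(k+1), and induction
  applies.\<close>

lemma Ck_on_linear_inverse:
  fixes A M :: "'a::real_normed_vector \<Rightarrow> 'b::euclidean_space \<Rightarrow> 'b"
  assumes U: "open U"
    and linA: "\<And>x. x \<in> U \<Longrightarrow> linear (A x)" and linM: "\<And>x. x \<in> U \<Longrightarrow> linear (M x)"
    and MA: "\<And>x h. x \<in> U \<Longrightarrow> M x (A x h) = h" and AM: "\<And>x h. x \<in> U \<Longrightarrow> A x (M x h) = h"
    and "\<And>h. Ck_on k U (\<lambda>x. A x h)"
  shows "Ck_on k U (\<lambda>x. M x h)"
  using assms(6)
proof (induction k arbitrary: h)
  case 0
  then show ?case using continuous_on_linear_inverse[of U A M, OF linA linM MA AM] by simp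
next
  case (Suc k)
  have IH: "Ck_on k U (\<lambda>x. M x h)" for h
    using Suc.IH Suc.prems Ck_on_SucD by blast
  have "\<forall>z. \<exists>D. (\<forall>x\<in>U. ((\<lambda>x. A x z) has_derivative D x) (at x)) \<and> (\<forall>h. Ck_on k U (\<lambda>x. D x h))"
    using Suc.prems by simp
  then obtain D where D: "\<And>z x. x\<in>U \<Longrightarrow> ((\<lambda>x. A x z) has_derivative D z x) (at x)"
      "\<And>z h. Ck_on k U (\<lambda>x. D z x h)"
    by metis
  have cM: "isCont (\<lambda>y. M y h) x" if "x \<in> U" for x h
    using continuous_on_linear_inverse[of U A M, OF linA linM MA AM] that U
      Ck_on_mono[OF Suc.prems, of 0] continuous_on_eq_continuous_at by fastforce
  \<comment> \<open>\<open>E x k\<close> is the derivative of A in direction \<open>k\<close>,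
    applied to the vector \<open>M x h\<close>. This vector varies with \<open>x\<close> while
    \<open>D\<close> treats fixed vectors, hence the basis expansion. \<open>M'\<close> is then - M
    x (E x k), expanded for the same reason.\<close>
  define E where "E x k = (\<Sum>b\<in>Basis. (M x h \<bullet> b) *\<^sub>R D b x k)" for x k
  define M' where "M' x k = - (\<Sum>b'\<in>Basis. (E x k \<bullet> b') *\<^sub>R M x b')" for x k
  have "((\<lambda>y. M y h) has_derivative M' x) (at x)" if x: "x \<in> U" for x
  proof -
    \<comment> \<open>Freezing z = M x h at the base point gives M y h = M x h - M y (A y z - A x
      z). Here A y z - A x z vanishes at y = x, so continuity of M is enough to differentiate the
      product.\<close>
    define z where "z = M x h"
    define u where "u y = (\<Sum>b\<in>Basis. (z \<bullet> b) *\<^sub>R (A y b - A x b))" for y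
    have u: "u y = A y z - A x z" if "y \<in> U" for y
      using linear_basis_expansion[OF linA[OF that], of z] linear_basis_expansion[OF linA[OF x], of z]
      by (simp add: u_def scaleR_diff_right sum_subtractf)
    have du: "(u has_derivative E x) (at x)"
      unfolding u_def E_def z_def
      by (auto intro!: derivative_eq_intros D(1)[OF x])
    have "((\<lambda>y. (u y \<bullet> b') *\<^sub>R M y b') has_derivative (\<lambda>k. (E x k \<bullet> b') *\<^sub>R M x b')) (at x)" for b'
      by (intro has_derivative_scaleR_zero cM x bounded_linear.has_derivative[OF bounded_linear_inner_left] du)
        (simp add: u_def)
    then have "((\<lambda>y. M x h - (\<Sum>b'\<in>Basis. (u y \<bullet> b') *\<^sub>R M y b')) has_derivative
       (\<lambda>k. 0 - (\<Sum>b'\<in>Basis. (E x k \<bullet> b') *\<^sub>R M x b'))) (at x)"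
      by (intro has_derivative_diff has_derivative_const has_derivative_sum)
    then have "((\<lambda>y. M x h - (\<Sum>b'\<in>Basis. (u y \<bullet> b') *\<^sub>R M y b')) has_derivative M' x) (at x)"
      by (simp add: M'_def[abs_def])
    moreover have "M x h - (\<Sum>b'\<in>Basis. (u y \<bullet> b') *\<^sub>R M y b') = M y h" if y: "y \<in> U" for y
    proof -
      have "(\<Sum>b'\<in>Basis. (u y \<bullet> b') *\<^sub>R M y b') = M y (A y z - A x z)"
        using linear_basis_expansion[OF linM[OF y]] u[OF y] by metis
      also have "\<dots> = M x h - M y h"
        using linM[OF y] by (simp add: linear_diff MA AM x y z_def)
      finally show ?thesis by simp
    qed
    ultimately show ?thesis
      by (rule has_derivative_transform_within_open[OF _ U x])
  qed
  moreover have "Ck_on k U (\<lambda>x. M' x v)" for v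
    unfolding M'_def E_def
    by (intro Ck_on_minus Ck_on_sum Ck_on_scaleR Ck_on_inner_left IH D(2))
  ultimately show ?case unfolding Ck_on.simps by (intro exI[of _ M']) blast
qed

text \<open>The inverse function theorem gives a differentiable inverse with derivative inv (F' (G
  y)); its higher smoothness is then bootstrapped from this formula. Bijectivity of the derivative
  on all of \<open>U\<close> is recorded because the method extrapolates only where J_F is
  invertible.\<close>

theorem Ck_inverse_function:
  fixes F :: "'a::euclidean_space \<Rightarrow> 'a"
  assumes F: "Ck_on (Suc k) UNIV F" and F0: "(F has_derivative F0) (at x0)" and "inj F0"
  obtains U V G where "open U" "x0 \<in> U" "open V" "F x0 \<in> V" "homeomorphism U V F G"
    "Ck_on (Suc k) V G" "\<And>x. x \<in> U \<Longrightarrow> bij (frechet_derivative F (at x))"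
proof -
  obtain F' where F': "\<And>x. (F has_derivative F' x) (at x)" "\<And>h. Ck_on k UNIV (\<lambda>x. F' x h)"
    using F by auto
  have F'_eq: "frechet_derivative F (at x) = F' x" for x
    using F'(1) frechet_derivative_at by metis
  have bl: "bounded_linear (F' x)" for x using F'(1) by (rule has_derivative_bounded_linear)
  have "F' x0 = F0" using F'(1) F0 by (rule has_derivative_unique)
  with \<open>inj F0\<close> have inj: "inj (F' x0)" by simp
  obtain g where g: "linear g" "g \<circ> F' x0 = id"
    using linear_injective_left_inverse[OF bounded_linear.linear[OF bl] inj] by blast
  have blg: "bounded_linear g" using g by (simp add: linear_conv_bounded_linear)
  \<comment> \<open>In finite dimension, continuity in every fixed direction yields continuity of
    the derivative in operator norm.\<close>
  have cont: "continuous_on UNIV (\<lambda>x. Blinfun (F' x))"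
    using Ck_on_mono[OF F'(2), of 0]
    by (intro continuous_on_blinfun_componentwise) (simp add: bounded_linear_Blinfun_apply[OF bl])
  have inv: "Blinfun g o\<^sub>L Blinfun (F' x0) = id_blinfun"
    using g(2)
    by (intro blinfun_eqI)
      (simp add: bounded_linear_Blinfun_apply[OF bl] bounded_linear_Blinfun_apply[OF blg] fun_eq_iff)
  have der: "(F has_derivative blinfun_apply (Blinfun (F' x))) (at x)" for x
    by (simp add: bounded_linear_Blinfun_apply[OF bl] F'(1))
  obtain U V G G' where "open U" "U \<subseteq> UNIV" "x0 \<in> U" "open V" "F x0 \<in> V" "homeomorphism U V F G"
    and G'B: "\<And>y. y \<in> V \<Longrightarrow> (G has_derivative G' y) (at y)"
      "\<And>y. y \<in> V \<Longrightarrow> G' y = inv (blinfun_apply (Blinfun (F' (G y))))"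
      "\<And>y. y \<in> V \<Longrightarrow> bij (blinfun_apply (Blinfun (F' (G y))))"
    by (rule inverse_function_theorem[OF open_UNIV der cont UNIV_I inv]) (rule that)
  note UV = this(1,3-6)
  note G' = G'B[unfolded bounded_linear_Blinfun_apply[OF bl]]
  have GF: "F x \<in> V" "G (F x) = x" if "x \<in> U" for x
    using UV(5) that by (auto simp: homeomorphism_def)
  have FG: "G y \<in> U" "F (G y) = y" if "y \<in> V" for y
    using UV(5) that by (auto simp: homeomorphism_def)
  have bij: "bij (F' x)" if "x \<in> U" for x using G'(3)[of "F x"] GF[OF that] by simp
  have lin: "linear (inv (F' x))" if "x \<in> U" for x
    using has_derivative_linear[OF G'(1)[of "F x"]] G'(2)[of "F x"] GF[OF that] by simp
  have M: "Ck_on k U (\<lambda>x. inv (F' x) h)" for h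
  proof (rule Ck_on_linear_inverse[OF UV(1), of F'])
    show "Ck_on k U (\<lambda>x. F' x h)" for h using F'(2) by (rule Ck_on_subset) simp
    show "inv (F' x) (F' x h) = h" "F' x (inv (F' x) h) = h" if "x \<in> U" for x h
      using bij[OF that] by (simp_all add: bij_is_inj bij_is_surj surj_f_inv_f)
  qed (use lin bounded_linear.linear[OF bl] in blast)+
  \<comment> \<open>If G is of class C^j with j \<le> k, then its derivative is the composition of
    the C^k map x \<mapsto> inv (F' x) with G, hence again of class C^j, and G is of class
    C^(j+1).\<close>
  have "j \<le> Suc k \<Longrightarrow> Ck_on j V G" for j
  proof (induction j)
    case 0
    then show ?case using UV(5) by (simp add: homeomorphism_def)
  next
    case (Suc j)
    have "Ck_on j V (\<lambda>y. inv (F' (G y)) h)" for h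
    proof (rule Ck_on_compose[where f = "\<lambda>x. inv (F' x) h" and U = U and g = G])
      show "Ck_on j U (\<lambda>x. inv (F' x) h)" using Suc.prems by (intro Ck_on_mono[OF M]) simp
      show "Ck_on j V G" using Suc by simp
      show "G ` V \<subseteq> U" using FG(1) by blast
    qed
    moreover have "(G has_derivative inv (F' (G y))) (at y)" if "y \<in> V" for y
      using G'(1)[OF that] G'(2)[OF that] by simp
    ultimately show ?case
      unfolding Ck_on.simps by (intro exI[of _ "\<lambda>y. inv (F' (G y))"]) blast
  qed
  then have "Ck_on (Suc k) V G" by blast
  then show ?thesis by (rule that[OF UV]) (unfold F'_eq, rule bij)
qed

text \<open>The coefficients may depend on \<open>x\<close> and \<open>u\<close>, but
  \<open>C\<close> may not: this uniformity is what the extrapolation estimate needs. The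
  coefficients are never identified with derivatives; the expansion of the derivative, given by
  induction, is integrated along the line through \<open>x\<close> in direction
  \<open>u\<close>.\<close>

lemma Ck_on_directional_Taylor:
  fixes f :: "'a::euclidean_space \<Rightarrow> 'b::real_normed_vector"
  assumes "Ck_on k U f" and K: "compact K" "convex K" "K \<subseteq> U"
  shows "\<exists>C\<ge>0. \<forall>x\<in>K. \<forall>u. norm u \<le> 1 \<longrightarrow> (\<exists>a::nat \<Rightarrow> 'b. \<forall>t. x + t *\<^sub>R u \<in> K \<longrightarrow>
           norm (f (x + t *\<^sub>R u) - (\<Sum>q<k. t ^ q *\<^sub>R a q)) \<le> C * \<bar>t\<bar> ^ k)"
  using assms(1)
proof (induction k arbitrary: f)
  case 0
  then have "compact (f ` K)"
    using K by (auto intro!: compact_continuous_image intro: continuous_on_subset)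
  then obtain B where "\<forall>y \<in> f ` K. norm y \<le> B"
    using compact_imp_bounded bounded_iff by blast
  then have "norm (f y) \<le> max B 0" if "y \<in> K" for y using that by force
  then show ?case by (intro exI[of _ "max B 0"]) auto
next
  case (Suc k)
  from Suc.prems obtain f' where
    f': "\<And>x. x \<in> U \<Longrightarrow> (f has_derivative f' x) (at x)" "\<And>h. Ck_on k U (\<lambda>x. f' x h)" by auto
  have "\<forall>b. \<exists>C\<ge>0. \<forall>x\<in>K. \<forall>u. norm u \<le> 1 \<longrightarrow> (\<exists>a::nat \<Rightarrow> 'b. \<forall>t. x + t *\<^sub>R u \<in> K \<longrightarrow>
           norm (f' (x + t *\<^sub>R u) b - (\<Sum>q<k. t ^ q *\<^sub>R a q)) \<le> C * \<bar>t\<bar> ^ k)"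
    using Suc.IH[OF f'(2)] by blast
  then obtain C where C0: "\<And>b. C b \<ge> 0" and C: "\<And>b. \<forall>x\<in>K. \<forall>u. norm u \<le> 1 \<longrightarrow>
        (\<exists>a::nat \<Rightarrow> 'b. \<forall>t. x + t *\<^sub>R u \<in> K \<longrightarrow>
           norm (f' (x + t *\<^sub>R u) b - (\<Sum>q<k. t ^ q *\<^sub>R a q)) \<le> C b * \<bar>t\<bar> ^ k)"
    by metis
  \<comment> \<open>The derivative along \<open>u\<close> combines the basis directions with weights
    of absolute value at most 1, so the constants of these directions add up.\<close>
  define D where "D = (\<Sum>b\<in>Basis. C b)"
  have "\<exists>a::nat \<Rightarrow> 'b. \<forall>t. x + t *\<^sub>R u \<in> K \<longrightarrow>
           norm (f (x + t *\<^sub>R u) - (\<Sum>q<Suc k. t ^ q *\<^sub>R a q)) \<le> D * \<bar>t\<bar> ^ Suc k"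
    if x: "x \<in> K" and u: "norm u \<le> 1" for x u
  proof -
    have "\<forall>b. \<exists>a::nat \<Rightarrow> 'b. \<forall>t. x + t *\<^sub>R u \<in> K \<longrightarrow>
           norm (f' (x + t *\<^sub>R u) b - (\<Sum>q<k. t ^ q *\<^sub>R a q)) \<le> C b * \<bar>t\<bar> ^ k"
      using C x u by blast
    then obtain a where a: "\<And>b t. x + t *\<^sub>R u \<in> K \<Longrightarrow>
           norm (f' (x + t *\<^sub>R u) b - (\<Sum>q<k. t ^ q *\<^sub>R a b q)) \<le> C b * \<bar>t\<bar> ^ k"
      by metis
    define a' where "a' q = (\<Sum>b\<in>Basis. (u \<bullet> b) *\<^sub>R a b q)" for q
    \<comment> \<open>The polynomial with coefficients \<open>A\<close> is the primitive of the one
      with coefficients \<open>a'\<close> whose constant term is \<open>f x\<close>. Hence the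
      remainder \<open>g\<close> vanishes at 0 and has derivative \<open>g'\<close>.\<close>
    define A where "A q = (case q of 0 \<Rightarrow> f x | Suc q \<Rightarrow> (1 / real (Suc q)) *\<^sub>R a' q)" for q
    define g where "g t = f (x + t *\<^sub>R u) - (\<Sum>q<Suc k. t ^ q *\<^sub>R A q)" for t
    define g' where "g' t = f' (x + t *\<^sub>R u) u - (\<Sum>q<k. t ^ q *\<^sub>R a' q)" for t
    have g0: "g 0 = 0"
      by (simp add: g_def A_def sum.lessThan_Suc_shift del: sum.lessThan_Suc)
    have dg: "(g has_derivative (\<lambda>h. h *\<^sub>R g' t)) (at t)" if "x + t *\<^sub>R u \<in> K" for t
    proof -
      have xtU: "x + t *\<^sub>R u \<in> U" using that K by auto
      have lin: "linear (f' (x + t *\<^sub>R u))" using f'(1)[OF xtU] has_derivative_linear by blast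
      have "((\<lambda>t. f (x + t *\<^sub>R u)) has_derivative (\<lambda>h. f' (x + t *\<^sub>R u) (h *\<^sub>R u))) (at t)"
        by (rule has_derivative_compose[of "\<lambda>t. x + t *\<^sub>R u", OF _ f'(1)[OF xtU]])
          (auto intro!: derivative_eq_intros)
      then have 1: "((\<lambda>t. f (x + t *\<^sub>R u)) has_derivative (\<lambda>h. h *\<^sub>R f' (x + t *\<^sub>R u) u)) (at t)"
        by (simp add: linear_scale[OF lin])
      have "((\<lambda>t. t ^ Suc q *\<^sub>R A (Suc q)) has_derivative (\<lambda>h. h *\<^sub>R t ^ q *\<^sub>R a' q)) (at t)" for q
      proof -
        have "((\<lambda>t. t ^ Suc q) has_derivative (\<lambda>h. real (Suc q) * t ^ q * h)) (at t)"
          using DERIV_pow[of "Suc q" t UNIV] by (simp add: has_field_derivative_def)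
        from has_derivative_scaleR_left[OF this, of "A (Suc q)"] show ?thesis
          by (simp add: A_def mult_ac del: power_Suc of_nat_Suc)
      qed
      then have "((\<lambda>t. A 0 + (\<Sum>q<k. t ^ Suc q *\<^sub>R A (Suc q))) has_derivative
          (\<lambda>h. 0 + (\<Sum>q<k. h *\<^sub>R t ^ q *\<^sub>R a' q))) (at t)"
        by (intro has_derivative_add has_derivative_const has_derivative_sum)
      then have 2: "((\<lambda>t. \<Sum>q<Suc k. t ^ q *\<^sub>R A q) has_derivative
          (\<lambda>h. h *\<^sub>R (\<Sum>q<k. t ^ q *\<^sub>R a' q))) (at t)"
        by (simp add: sum.lessThan_Suc_shift scaleR_sum_right del: sum.lessThan_Suc)
      show ?thesis
        unfolding g_def g'_def scaleR_diff_right by (intro has_derivative_diff 1 2)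
    qed
    have g'_le: "norm (g' t) \<le> D * \<bar>t\<bar> ^ k" if tK: "x + t *\<^sub>R u \<in> K" for t
    proof -
      have "x + t *\<^sub>R u \<in> U" using that K by auto
      then have "f' (x + t *\<^sub>R u) u = (\<Sum>b\<in>Basis. (u \<bullet> b) *\<^sub>R f' (x + t *\<^sub>R u) b)"
        using f'(1) has_derivative_linear linear_basis_expansion by blast
      moreover have "(\<Sum>q<k. t ^ q *\<^sub>R a' q) = (\<Sum>b\<in>Basis. (u \<bullet> b) *\<^sub>R (\<Sum>q<k. t ^ q *\<^sub>R a b q))"
        unfolding a'_def scaleR_sum_right by (subst sum.swap) (simp add: mult.commute)
      ultimately have "g' t = (\<Sum>b\<in>Basis. (u \<bullet> b) *\<^sub>R (f' (x + t *\<^sub>R u) b - (\<Sum>q<k. t ^ q *\<^sub>R a b q)))"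
        by (simp add: g'_def scaleR_diff_right sum_subtractf)
      also have "norm \<dots> \<le> (\<Sum>b\<in>Basis. C b * \<bar>t\<bar> ^ k)"
      proof (rule sum_norm_le)
        fix b :: 'a assume "b \<in> Basis"
        then have "\<bar>u \<bullet> b\<bar> \<le> 1" using u Basis_le_norm order_trans by blast
        then have "\<bar>u \<bullet> b\<bar> * norm (f' (x + t *\<^sub>R u) b - (\<Sum>q<k. t ^ q *\<^sub>R a b q)) \<le> 1 * (C b * \<bar>t\<bar> ^ k)"
          using a[OF tK, of b] by (intro mult_mono) auto
        then show "norm ((u \<bullet> b) *\<^sub>R (f' (x + t *\<^sub>R u) b - (\<Sum>q<k. t ^ q *\<^sub>R a b q))) \<le> C b * \<bar>t\<bar> ^ k"
          by simp
      qed
      finally show ?thesis by (simp add: D_def sum_distrib_right)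
    qed
    have "norm (g t) \<le> D * \<bar>t\<bar> ^ Suc k" if tK: "x + t *\<^sub>R u \<in> K" for t
    proof -
      \<comment> \<open>Convexity keeps the whole segment in \<open>K\<close>, so the bound on
        \<open>g'\<close> holds along it and the mean value inequality gains one power of
        \<open>t\<close>. The parameter \<open>t\<close> may be negative, hence a closed segment
        rather than an interval.\<close>
      have seg: "x + s *\<^sub>R u \<in> K \<and> \<bar>s\<bar> \<le> \<bar>t\<bar>" if s: "s \<in> closed_segment 0 t" for s
      proof -
        obtain \<theta> where \<theta>: "0 \<le> \<theta>" "\<theta> \<le> 1" "s = \<theta> * t"
          using s unfolding in_segment by auto
        have "x + s *\<^sub>R u = (1 - \<theta>) *\<^sub>R x + \<theta> *\<^sub>R (x + t *\<^sub>R u)"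
          unfolding \<theta>(3) by (simp add: algebra_simps)
        also have "\<dots> \<in> K" using \<theta>(1,2) by (intro convexD_alt[OF K(2) x tK])
        finally have "x + s *\<^sub>R u \<in> K" .
        moreover have "\<bar>s\<bar> \<le> \<bar>t\<bar>"
          using \<theta>(1,2) unfolding \<theta>(3) by (simp add: abs_mult mult_left_le_one_le)
        ultimately show ?thesis ..
      qed
      have D0: "D \<ge> 0" using C0 by (simp add: D_def sum_nonneg)
      have "norm (g t - g 0) \<le> (D * \<bar>t\<bar> ^ k) * norm (t - 0)"
      proof (rule differentiable_bound[of "closed_segment 0 t"])
        fix s assume s: "s \<in> closed_segment 0 t"
        show "(g has_derivative (\<lambda>h. h *\<^sub>R g' s)) (at s within closed_segment 0 t)"
          using dg seg[OF s] has_derivative_at_withinI by blast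
        have "norm (g' s) \<le> D * \<bar>t\<bar> ^ k"
          using g'_le[of s] seg[OF s] D0 mult_left_mono[OF power_mono[of "\<bar>s\<bar>" "\<bar>t\<bar>" k] D0] by force
        then have "norm (h *\<^sub>R g' s) \<le> D * \<bar>t\<bar> ^ k * norm h" for h
          using mult_right_mono[of "norm (g' s)" "D * \<bar>t\<bar> ^ k" "\<bar>h\<bar>"] by (simp add: mult.commute)
        then show "onorm (\<lambda>h. h *\<^sub>R g' s) \<le> D * \<bar>t\<bar> ^ k" by (intro onorm_le)
      qed auto
      then show ?thesis by (simp add: g0 mult_ac)
    qed
    then show ?thesis unfolding g_def by blast
  qed
  moreover have "D \<ge> 0" using C0 by (simp add: D_def sum_nonneg)
  ultimately show ?case by blast
qed

text \<open>This is the first-order case of the uniform Taylor bound along the direction from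
  \<open>x\<close> to \<open>y\<close>; evaluating it at t = 0 forces the constant coefficient to be
  \<open>f x\<close>.\<close>

lemma Ck_on_imp_Lipschitz:
  fixes f :: "'a::euclidean_space \<Rightarrow> 'b::real_normed_vector"
  assumes "Ck_on (Suc k) U f" and K: "compact K" "convex K" "K \<subseteq> U"
  shows "\<exists>L\<ge>0. \<forall>x\<in>K. \<forall>y\<in>K. norm (f x - f y) \<le> L * norm (x - y)"
proof -
  have "Ck_on 1 U f" using assms(1) by (rule Ck_on_mono) simp
  from Ck_on_directional_Taylor[OF this K]
  obtain C where C: "C \<ge> 0" "\<And>x u. x\<in>K \<Longrightarrow> norm u \<le> 1 \<Longrightarrow> (\<exists>a::nat \<Rightarrow> 'b. \<forall>t. x + t *\<^sub>R u \<in> K \<longrightarrow>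
           norm (f (x + t *\<^sub>R u) - a 0) \<le> C * \<bar>t\<bar>)" by auto
  have "norm (f x - f y) \<le> C * norm (x - y)" if "x \<in> K" "y \<in> K" for x y
  proof -
    define u where "u = (1 / norm (y - x)) *\<^sub>R (y - x)"
    have y: "x + norm (y - x) *\<^sub>R u = y" by (simp add: u_def)
    have "norm u \<le> 1" by (simp add: u_def)
    from C(2)[OF that(1) this] obtain a :: "nat \<Rightarrow> 'b"
      where a: "\<And>t. x + t *\<^sub>R u \<in> K \<Longrightarrow> norm (f (x + t *\<^sub>R u) - a 0) \<le> C * \<bar>t\<bar>" by blast
    have "a 0 = f x" using a[of 0] that by simp
    then show ?thesis using a[of "norm (y - x)"] that y by (simp add: norm_minus_commute)
  qed
  then show ?thesis using C(1) by blast
qed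

text \<open>Letting t tend to 0 gives b 0 = 0; dividing by t then leaves a polynomial and a bound of
  one order less.\<close>

lemma polynomial_bigo_eq_0:
  fixes b :: "nat \<Rightarrow> 'b::real_normed_vector"
  assumes "\<forall>\<^sub>F t in at (0::real). norm (\<Sum>q<n. t ^ q *\<^sub>R b q) \<le> C * \<bar>t\<bar> ^ n"
  shows "q < n \<Longrightarrow> b q = 0"
  using assms
proof (induction n arbitrary: b q)
  case (Suc n)
  have split: "(\<Sum>q<Suc n. t ^ q *\<^sub>R b q) = b 0 + t *\<^sub>R (\<Sum>q<n. t ^ q *\<^sub>R b (Suc q))" for t :: real
    by (simp add: sum.lessThan_Suc_shift scaleR_sum_right del: sum.lessThan_Suc)
  have "((\<lambda>t. \<Sum>q<Suc n. t ^ q *\<^sub>R b q) \<longlongrightarrow> 0) (at (0::real))"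
  proof (rule Lim_null_comparison[OF Suc.prems(2)])
    have "((\<lambda>t::real. C * \<bar>t\<bar> ^ Suc n) \<longlongrightarrow> C * \<bar>0\<bar> ^ Suc n) (at 0)" by (intro tendsto_intros)
    then show "((\<lambda>t::real. C * \<bar>t\<bar> ^ Suc n) \<longlongrightarrow> 0) (at 0)" by simp
  qed
  moreover have "((\<lambda>t. b 0 + t *\<^sub>R (\<Sum>q<n. t ^ q *\<^sub>R b (Suc q))) \<longlongrightarrow> 
      b 0 + 0 *\<^sub>R (\<Sum>q<n. 0 ^ q *\<^sub>R b (Suc q))) (at (0::real))"
    by (intro tendsto_intros)
  ultimately have b0: "b 0 = 0" 
    unfolding split using tendsto_unique[OF trivial_limit_at] by fastforce
  have "\<forall>\<^sub>F t in at (0::real). norm (\<Sum>q<n. t ^ q *\<^sub>R b (Suc q)) \<le> C * \<bar>t\<bar> ^ n"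
    using Suc.prems(2) eventually_at_ball'[of 1 "0::real" UNIV, OF zero_less_one]
  proof (eventually_elim, unfold split b0)
    fix t :: real assume *: "norm (0 + t *\<^sub>R (\<Sum>q<n. t ^ q *\<^sub>R b (Suc q))) \<le> C * \<bar>t\<bar> ^ Suc n"
      and "t \<in> ball 0 1 \<and> t \<noteq> 0 \<and> t \<in> UNIV"
    then have "\<bar>t\<bar> > 0" by simp
    have "\<bar>t\<bar> * norm (\<Sum>q<n. t ^ q *\<^sub>R b (Suc q)) \<le> \<bar>t\<bar> * (C * \<bar>t\<bar> ^ n)"
      using * by (simp add: mult_ac)
    then show "norm (\<Sum>q<n. t ^ q *\<^sub>R b (Suc q)) \<le> C * \<bar>t\<bar> ^ n"
      using \<open>\<bar>t\<bar> > 0\<close> by (simp add: mult_le_cancel_left_pos)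
  qed
  then have "b (Suc q) = 0" if "q < n" for q using Suc.IH[of q "\<lambda>q. b (Suc q)"] that by blast
  with b0 Suc.prems(1) show ?case by (cases q) auto
qed auto

section \<open>The extrapolation step\<close>

lemma polycurve_eq_sum:
  "polycurve w v p s \<rho> =
     (\<Sum>q<Suc p. (\<rho> - s) ^ q *\<^sub>R (if q = 0 then w else (1 / fact q) *\<^sub>R v q))"
proof -
  have "(\<Sum>q=1..p. ((\<rho> - s) ^ q / fact q) *\<^sub>R v q) = (\<Sum>q<p. ((\<rho> - s) ^ Suc q / fact (Suc q)) *\<^sub>R v (Suc q))"
    using sum.atLeast1_atMost_eq[of "\<lambda>q. ((\<rho> - s) ^ q / fact q) *\<^sub>R v q" p] by simp
  then show ?thesis
    unfolding polycurve_def sum.lessThan_Suc_shift by simp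
qed

lemma polycurve_tendsto: "(polycurve w v p s \<longlongrightarrow> w) (at s)"
proof -
  have "((\<lambda>\<rho>. w + (\<Sum>q=1..p. ((\<rho> - s) ^ q / fact q) *\<^sub>R v q)) \<longlongrightarrow>
      w + (\<Sum>q=1..p. ((s - s) ^ q / fact q) *\<^sub>R v q)) (at s)"
    by (intro tendsto_intros) auto
  moreover have "(\<Sum>q=1..p. ((s - s) ^ q / fact q) *\<^sub>R v q) = 0"
    by (rule sum.neutral) auto
  ultimately show ?thesis by (simp add: polycurve_def[abs_def])
qed

lemma norm_nml_le: "norm (nml r) \<le> 1"
  by (simp add: nml_def)

lemma norm_scaleR_nml: "norm r *\<^sub>R nml r = r"
  by (simp add: nml_def)

text \<open>The curves share the constant term \<open>w\<close>, so their difference is a polynomial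
  of degree at most \<open>p\<close> that is of order \<open>p + 1\<close> at \<open>s\<close>,
  hence zero. Fixing \<open>v\<close> to be 0 outside 1..p turns equality of coefficients into
  equality of functions, as the definite description in \<open>extrap\<close> demands.\<close>

lemma polycurve_unique:
  fixes w :: "'a::real_normed_vector"
  assumes v: "\<And>q. q = 0 \<or> p < q \<Longrightarrow> v q = 0" and v': "\<And>q. q = 0 \<or> p < q \<Longrightarrow> v' q = 0"
    and le: "\<forall>\<^sub>F \<rho> in at s. norm (polycurve w v p s \<rho> - polycurve w v' p s \<rho>) \<le> C * \<bar>\<rho> - s\<bar> ^ Suc p"
  shows "v = v'"
proof
  fix q
  define b where "b q = (if q = 0 then 0 else (1 / fact q) *\<^sub>R (v q - v' q))" for q
  have "polycurve w v p s \<rho> - polycurve w v' p s \<rho> = (\<Sum>q<Suc p. (\<rho> - s) ^ q *\<^sub>R b q)" for \<rho>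
    unfolding polycurve_eq_sum sum_subtractf[symmetric]
    by (rule sum.cong) (auto simp: b_def scaleR_diff_right)
  then have "\<forall>\<^sub>F t in at 0. norm (\<Sum>q<Suc p. t ^ q *\<^sub>R b q) \<le> C * \<bar>t\<bar> ^ Suc p"
    using le[unfolded eventually_at_to_0[of _ s]] by simp
  then have "q < Suc p \<Longrightarrow> b q = 0" by (rule polynomial_bigo_eq_0)
  then show "v q = v' q" using v v' by (cases "q = 0 \<or> p < q") (auto simp: b_def)
qed

text \<open>Applied to residuals \<open>y k\<close> and the local inverse \<open>G\<close>, this
  converts the limit of residual over \<mu> into the limit of error over \<mu>.\<close>

lemma has_derivative_difference_quotient_LIMSEQ:
  fixes G :: "'a::real_normed_vector \<Rightarrow> 'b::real_normed_vector"
  assumes G: "(G has_derivative G') (at x)" and pos: "\<And>k. \<mu> k > 0" and \<mu>: "\<mu> \<longlonglongrightarrow> 0"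
    and y: "(\<lambda>k. (y k - x) /\<^sub>R \<mu> k) \<longlonglongrightarrow> e"
  shows "(\<lambda>k. (G (y k) - G x) /\<^sub>R \<mu> k) \<longlonglongrightarrow> G' e"
proof -
  interpret G': bounded_linear G' using G by (rule has_derivative_bounded_linear)
  \<comment> \<open>Since division by zero yields 0, \<open>R x = 0\<close> and \<open>R\<close> is
    continuous at \<open>x\<close>; so \<open>R (y k)\<close> tends to 0 even if some
    \<open>y k\<close> equal \<open>x\<close>.\<close>
  define R where "R z = (G z - G x - G' (z - x)) /\<^sub>R norm (z - x)" for z
  have Rx: "R x = 0" by (simp add: R_def)
  have "(R \<longlongrightarrow> R x) (at x)" using G unfolding Rx R_def has_derivative_at_within by simp
  then have cont: "isCont R x" by (simp add: isCont_def)
  have "(\<lambda>k. \<mu> k *\<^sub>R ((y k - x) /\<^sub>R \<mu> k)) \<longlonglongrightarrow> 0 *\<^sub>R e" by (intro tendsto_scaleR \<mu> y)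
  moreover have "\<mu> k *\<^sub>R ((y k - x) /\<^sub>R \<mu> k) = y k - x" for k using pos[of k] by simp
  ultimately have "(\<lambda>k. y k - x) \<longlonglongrightarrow> 0" by simp
  then have "y \<longlonglongrightarrow> x" by (rule LIM_zero_cancel)
  then have "(\<lambda>k. R (y k)) \<longlonglongrightarrow> 0" using isCont_tendsto_compose[OF cont] Rx by metis
  then have "(\<lambda>k. G' ((y k - x) /\<^sub>R \<mu> k) + norm ((y k - x) /\<^sub>R \<mu> k) *\<^sub>R R (y k)) \<longlonglongrightarrow> G' e + norm e *\<^sub>R 0"
    by (intro tendsto_intros G'.tendsto y)
  moreover have "G' ((y k - x) /\<^sub>R \<mu> k) + norm ((y k - x) /\<^sub>R \<mu> k) *\<^sub>R R (y k) = (G (y k) - G x) /\<^sub>R \<mu> k" for k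
  proof -
    have "norm ((y k - x) /\<^sub>R \<mu> k) *\<^sub>R R (y k) = (G (y k) - G x - G' (y k - x)) /\<^sub>R \<mu> k"
      using pos[of k] by (cases "y k = x") (simp_all add: R_def)
    then show ?thesis by (simp only: G'.scaleR scaleR_add_right[symmetric]) simp
  qed
  ultimately show ?thesis by simp
qed

text \<open>From here on \<open>F\<close> stands for F^0, and each F^\<mu> is the shift F - \<mu> e
  by a fixed vector. The optimization problem enters only through the smooth local inverse
  \<open>G\<close> at a zero of \<open>F\<close>.\<close>

locale smooth_local_inverse =
  fixes F G :: "'a::euclidean_space \<Rightarrow> 'a" and U V :: "'a set" and ws :: 'a and p :: nat
  assumes smooth_F: "Ck_on (Suc p) UNIV F" and smooth_G: "Ck_on (Suc p) V G"
    and open_U: "open U" and ws_in_U: "ws \<in> U" and open_V: "open V" and F_ws: "F ws = 0"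
    and homeo: "homeomorphism U V F G"
begin

lemma F_in_V: "x \<in> U \<Longrightarrow> F x \<in> V"
  and G_F: "x \<in> U \<Longrightarrow> G (F x) = x"
  and F_G: "y \<in> V \<Longrightarrow> F (G y) = y"
  using homeo by (auto simp: homeomorphism_def)

lemma zero_in_V: "0 \<in> V"
  using F_in_V[OF ws_in_U] F_ws by simp

lemma G_zero: "G 0 = ws"
  using G_F[OF ws_in_U] F_ws by simp

lemma continuous_F: "continuous_on UNIV F"
  using Ck_on_mono[OF smooth_F, of 0] by simp

lemma continuous_G: "continuous_on V G"
  using homeo by (simp add: homeomorphism_def)

text \<open>The polynomial curve is the Taylor polynomial at \<rho> = s = norm r of the exact curve
  \<rho> \<mapsto> G (\<mu> e + \<rho> nml r), and evaluation at \<rho> = 0 is a step of length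
  \<open>s\<close>. The Taylor remainder is of order s^(p+1); Lipschitz bounds on \<open>F\<close>
  and \<open>G\<close> transfer it to the residual and to the distance from \<open>ws\<close>. All
  constants are independent of \<open>w\<close> and \<open>\<mu>\<close>.\<close>

lemma extrap_estimate:
  obtains \<delta> C where "\<delta> > 0" "C \<ge> 0"
    "\<And>w \<mu>. norm (w - ws) < \<delta> \<Longrightarrow> \<bar>\<mu>\<bar> < \<delta> \<Longrightarrow> norm (F w - \<mu> *\<^sub>R e) < \<delta> \<Longrightarrow>
       norm (F (extrap (\<lambda>z. F z - \<mu> *\<^sub>R e) p w) - \<mu> *\<^sub>R e) \<le> C * norm (F w - \<mu> *\<^sub>R e) ^ Suc p \<and>
       norm (extrap (\<lambda>z. F z - \<mu> *\<^sub>R e) p w - ws) \<le> C * (norm (F w - \<mu> *\<^sub>R e) ^ Suc p + \<bar>\<mu>\<bar>)"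
proof -
  obtain \<beta> where \<beta>: "\<beta> > 0" "cball 0 \<beta> \<subseteq> V"
    using open_contains_cball open_V zero_in_V by blast
  obtain C1 where C1: "C1 \<ge> 0" "\<And>x u. x \<in> cball 0 \<beta> \<Longrightarrow> norm u \<le> 1 \<Longrightarrow>
       \<exists>a. \<forall>t. x + t *\<^sub>R u \<in> cball 0 \<beta> \<longrightarrow>
           norm (G (x + t *\<^sub>R u) - (\<Sum>q<Suc p. t ^ q *\<^sub>R a q)) \<le> C1 * \<bar>t\<bar> ^ Suc p"
    using Ck_on_directional_Taylor[OF smooth_G compact_cball convex_cball \<beta>(2)] by blast
  obtain LG where LG: "LG \<ge> 0"
    "\<And>x y. x \<in> cball 0 \<beta> \<Longrightarrow> y \<in> cball 0 \<beta> \<Longrightarrow> norm (G x - G y) \<le> LG * norm (x - y)"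
    using Ck_on_imp_Lipschitz[OF smooth_G compact_cball convex_cball \<beta>(2)] by blast
  obtain LF where LF: "LF \<ge> 0"
    "\<And>x y. x \<in> cball ws 1 \<Longrightarrow> y \<in> cball ws 1 \<Longrightarrow> norm (F x - F y) \<le> LF * norm (x - y)"
    using Ck_on_imp_Lipschitz[OF smooth_F compact_cball convex_cball subset_UNIV] by blast
  have preimage_open: "open (U \<inter> F -` ball 0 \<beta>)"
    using continuous_F open_U by (intro open_Int open_vimage) auto
  obtain \<delta>1 where \<delta>1: "\<delta>1 > 0" "ball ws \<delta>1 \<subseteq> U \<inter> F -` ball 0 \<beta>"
    using openE[OF preimage_open, of ws] ws_in_U F_ws \<beta>(1)
    by (metis IntI centre_in_ball vimage_eq)
  \<comment> \<open>\<open>\<delta>1\<close> places \<open>w\<close> in \<open>U\<close> with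
    \<open>F w\<close> in the ball where \<open>G\<close> is controlled; \<delta> \<le> 1 gives
    s^(p+1) \<le> s; the third bound keeps \<mu> e in that ball; the last one keeps both the
    extrapolated point and G (\<mu> e) within distance 1 of \<open>ws\<close>, where
    \<open>LF\<close> is valid.\<close>
  define \<delta> where "\<delta> = min (min \<delta>1 1) (min (\<beta> / (norm e + 1)) (1 / (C1 + LG * norm e + 1)))"
  define C where "C = LF * C1 + C1 + LG * norm e"
  have N0: "norm e + 1 > 0" using norm_ge_zero[of e] by linarith
  have N1: "C1 + LG * norm e + 1 > 0"
    using C1(1) mult_nonneg_nonneg[OF LG(1) norm_ge_zero[of e]] by linarith
  have \<delta>: "\<delta> > 0" "\<delta> \<le> \<delta>1" "\<delta> \<le> 1" "\<delta> * (norm e + 1) \<le> \<beta>" "\<delta> * (C1 + LG * norm e + 1) \<le> 1"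
  proof -
    show "\<delta> > 0" using \<delta>1(1) \<beta>(1) N0 N1 by (simp add: \<delta>_def)
    show "\<delta> \<le> \<delta>1" "\<delta> \<le> 1" by (auto simp: \<delta>_def)
    have "\<delta> \<le> \<beta> / (norm e + 1)" "\<delta> \<le> 1 / (C1 + LG * norm e + 1)" by (auto simp: \<delta>_def)
    then show "\<delta> * (norm e + 1) \<le> \<beta>" "\<delta> * (C1 + LG * norm e + 1) \<le> 1"
      using N0 N1 by (simp_all add: pos_le_divide_eq)
  qed
  have est: "norm (F (extrap (\<lambda>z. F z - \<mu> *\<^sub>R e) p w) - \<mu> *\<^sub>R e) \<le> C * norm (F w - \<mu> *\<^sub>R e) ^ Suc p \<and>
       norm (extrap (\<lambda>z. F z - \<mu> *\<^sub>R e) p w - ws) \<le> C * (norm (F w - \<mu> *\<^sub>R e) ^ Suc p + \<bar>\<mu>\<bar>)"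
    if w: "norm (w - ws) < \<delta>" and \<mu>: "\<bar>\<mu>\<bar> < \<delta>" and r: "norm (F w - \<mu> *\<^sub>R e) < \<delta>" for w \<mu>
  proof -
    define r where "r = F w - \<mu> *\<^sub>R e"
    define s where "s = norm r"
    define u where "u = nml r"
    \<comment> \<open>Only norm u \<le> 1 is claimed, so that r = 0 with u = 0 is included.\<close>
    have u: "norm u \<le> 1" "s *\<^sub>R u = r" by (simp_all add: u_def s_def norm_nml_le norm_scaleR_nml)
    have wU: "w \<in> U \<inter> F -` ball 0 \<beta>"
      using w \<delta>(2) \<delta>1(2) by (auto simp: dist_norm norm_minus_commute subset_iff)
    \<comment> \<open>The line through \<open>F w\<close> in direction \<open>u\<close>,
      reparametrized to start at \<rho> = s, is the line through \<mu> e; this matches the Taylor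
      expansion at \<open>F w\<close> with the curve defining the extrapolation.\<close>
    have shift: "F w + (\<rho> - s) *\<^sub>R u = \<mu> *\<^sub>R e + \<rho> *\<^sub>R u" for \<rho>
      using u(2) by (simp add: r_def algebra_simps)
    have "F w \<in> cball 0 \<beta>" using wU by auto
    from C1(2)[OF this u(1)] obtain a where a: "\<And>t. F w + t *\<^sub>R u \<in> cball 0 \<beta> \<Longrightarrow>
           norm (G (F w + t *\<^sub>R u) - (\<Sum>q<Suc p. t ^ q *\<^sub>R a q)) \<le> C1 * \<bar>t\<bar> ^ Suc p"
      by blast
    have "(\<Sum>q<Suc p. 0 ^ q *\<^sub>R a q) = a 0"
      by (simp add: sum.lessThan_Suc_shift del: sum.lessThan_Suc)
    then have a0: "a 0 = w" using a[of 0] wU by (simp add: G_F del: sum.lessThan_Suc)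
    \<comment> \<open>The factorials undo the division by \<open>fact q\<close> in
      \<open>polycurve\<close>, so that \<open>P\<close> is exactly the Taylor polynomial with
      coefficients \<open>a\<close>.\<close>
    define v where "v q = (if 1 \<le> q \<and> q \<le> p then fact q *\<^sub>R a q else 0)" for q
    define P where "P = polycurve w v p s"
    have "P \<rho> = (\<Sum>q<Suc p. (\<rho> - s) ^ q *\<^sub>R a q)" for \<rho>
      unfolding P_def polycurve_eq_sum by (rule sum.cong) (auto simp: v_def a0)
    then have P: "norm (G (\<mu> *\<^sub>R e + \<rho> *\<^sub>R u) - P \<rho>) \<le> C1 * \<bar>\<rho> - s\<bar> ^ Suc p"
      if "\<mu> *\<^sub>R e + \<rho> *\<^sub>R u \<in> cball 0 \<beta>" for \<rho>
      using a[of "\<rho> - s"] that by (simp add: shift)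
    have lim: "((\<lambda>\<rho>. \<mu> *\<^sub>R e + \<rho> *\<^sub>R u) \<longlongrightarrow> F w) (at s)"
    proof -
      have "((\<lambda>\<rho>. \<mu> *\<^sub>R e + \<rho> *\<^sub>R u) \<longlongrightarrow> \<mu> *\<^sub>R e + s *\<^sub>R u) (at s)" by (intro tendsto_intros)
      then show ?thesis by (simp add: u(2) r_def)
    qed
    have in_ball: "\<forall>\<^sub>F \<rho> in at s. \<mu> *\<^sub>R e + \<rho> *\<^sub>R u \<in> ball 0 \<beta>"
      using wU by (intro topological_tendstoD[OF lim open_ball]) auto
    have w1: "w \<in> ball ws 1" using w \<delta>(3) by (simp add: dist_norm norm_minus_commute)
    have wV: "F w \<in> V" using wU F_in_V by blast
    have "isCont G (F w)"
      using continuous_G open_V wV continuous_on_eq_continuous_at by blast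
    from isCont_tendsto_compose[OF this lim]
    have "((\<lambda>\<rho>. G (\<mu> *\<^sub>R e + \<rho> *\<^sub>R u)) \<longlongrightarrow> w) (at s)" using wU by (simp add: G_F)
    then have G_near: "\<forall>\<^sub>F \<rho> in at s. G (\<mu> *\<^sub>R e + \<rho> *\<^sub>R u) \<in> ball ws 1"
      by (rule topological_tendstoD[OF _ open_ball w1])
    have P_near: "\<forall>\<^sub>F \<rho> in at s. P \<rho> \<in> ball ws 1"
      unfolding P_def by (rule topological_tendstoD[OF polycurve_tendsto open_ball w1])
    \<comment> \<open>This evaluates the definite description in \<open>extrap\<close>. Existence:
      the Taylor remainder of the exact curve is carried through \<open>F\<close> by its Lipschitz
      constant.\<close>
    have exact: "(THE v. (\<forall>q. (q = 0 \<or> p < q) \<longrightarrow> v q = 0) \<and>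
        (\<lambda>\<rho>. norm (F (polycurve w v p s \<rho>) - \<mu> *\<^sub>R e - \<rho> *\<^sub>R u)) \<in> O[at s](\<lambda>\<rho>. \<bar>\<rho> - s\<bar> ^ (p + 1))) = v"
    proof (rule the_equality, intro conjI)
      show "\<forall>q. (q = 0 \<or> p < q) \<longrightarrow> v q = 0" by (auto simp: v_def)
      show "(\<lambda>\<rho>. norm (F (polycurve w v p s \<rho>) - \<mu> *\<^sub>R e - \<rho> *\<^sub>R u)) \<in> O[at s](\<lambda>\<rho>. \<bar>\<rho> - s\<bar> ^ (p + 1))"
      proof (rule bigoI[of _ "LF * C1"])
        show "\<forall>\<^sub>F \<rho> in at s. norm (norm (F (polycurve w v p s \<rho>) - \<mu> *\<^sub>R e - \<rho> *\<^sub>R u))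
            \<le> LF * C1 * norm (\<bar>\<rho> - s\<bar> ^ (p + 1))"
          using in_ball G_near P_near
        proof eventually_elim
          fix \<rho> assume 1: "\<mu> *\<^sub>R e + \<rho> *\<^sub>R u \<in> ball 0 \<beta>" and 2: "G (\<mu> *\<^sub>R e + \<rho> *\<^sub>R u) \<in> ball ws 1"
            and 3: "P \<rho> \<in> ball ws 1"
          have "F (G (\<mu> *\<^sub>R e + \<rho> *\<^sub>R u)) = \<mu> *\<^sub>R e + \<rho> *\<^sub>R u" using 1 \<beta>(2) by (intro F_G) auto
          then have "norm (F (P \<rho>) - \<mu> *\<^sub>R e - \<rho> *\<^sub>R u) = norm (F (G (\<mu> *\<^sub>R e + \<rho> *\<^sub>R u)) - F (P \<rho>))"
            by (simp add: norm_minus_commute diff_diff_eq)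
          also have "\<dots> \<le> LF * norm (G (\<mu> *\<^sub>R e + \<rho> *\<^sub>R u) - P \<rho>)" using 2 3 by (intro LF(2)) auto
          also have "\<dots> \<le> LF * (C1 * \<bar>\<rho> - s\<bar> ^ Suc p)" using 1 LF(1) by (intro mult_left_mono P) auto
          finally show "norm (norm (F (polycurve w v p s \<rho>) - \<mu> *\<^sub>R e - \<rho> *\<^sub>R u))
            \<le> LF * C1 * norm (\<bar>\<rho> - s\<bar> ^ (p + 1))"
            by (simp add: P_def abs_mult mult.assoc power_abs)
        qed
      qed
    next
      fix v' assume v': "(\<forall>q. (q = 0 \<or> p < q) \<longrightarrow> v' q = 0) \<and>
        (\<lambda>\<rho>. norm (F (polycurve w v' p s \<rho>) - \<mu> *\<^sub>R e - \<rho> *\<^sub>R u)) \<in> O[at s](\<lambda>\<rho>. \<bar>\<rho> - s\<bar> ^ (p + 1))"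
      then obtain c where c: "\<forall>\<^sub>F \<rho> in at s. norm (norm (F (polycurve w v' p s \<rho>) - \<mu> *\<^sub>R e - \<rho> *\<^sub>R u))
            \<le> c * norm (\<bar>\<rho> - s\<bar> ^ (p + 1))"
        by (auto elim: landau_o.bigE)
      \<comment> \<open>Uniqueness goes the opposite way. A competing curve lies in \<open>U\<close>
        near \<open>s\<close>, so it equals \<open>G\<close> applied to its image under
        \<open>F\<close>; the Lipschitz bound on \<open>G\<close> turns its small residual into
        closeness to the exact curve, and hence to \<open>P\<close>.\<close>
      define P' where "P' = polycurve w v' p s"
      have "\<forall>\<^sub>F \<rho> in at s. P' \<rho> \<in> U \<inter> F -` ball 0 \<beta>"
        unfolding P'_def by (rule topological_tendstoD[OF polycurve_tendsto preimage_open wU])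
      then have close: "\<forall>\<^sub>F \<rho> in at s. norm (P' \<rho> - P \<rho>) \<le> (LG * c + C1) * \<bar>\<rho> - s\<bar> ^ Suc p"
        using in_ball c
      proof eventually_elim
        fix \<rho> assume 1: "P' \<rho> \<in> U \<inter> F -` ball 0 \<beta>" and 2: "\<mu> *\<^sub>R e + \<rho> *\<^sub>R u \<in> ball 0 \<beta>"
          and 3: "norm (norm (F (polycurve w v' p s \<rho>) - \<mu> *\<^sub>R e - \<rho> *\<^sub>R u)) \<le> c * norm (\<bar>\<rho> - s\<bar> ^ (p + 1))"
        have "norm (P' \<rho> - G (\<mu> *\<^sub>R e + \<rho> *\<^sub>R u)) = norm (G (F (P' \<rho>)) - G (\<mu> *\<^sub>R e + \<rho> *\<^sub>R u))"
          using 1 by (simp add: G_F)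
        also have "\<dots> \<le> LG * norm (F (P' \<rho>) - (\<mu> *\<^sub>R e + \<rho> *\<^sub>R u))"
          using 1 2 by (intro LG(2)) auto
        also have "\<dots> \<le> LG * (c * \<bar>\<rho> - s\<bar> ^ Suc p)"
          using 3 LG(1) by (intro mult_left_mono) (simp_all add: P'_def diff_diff_eq abs_mult power_abs)
        finally have "norm (P' \<rho> - G (\<mu> *\<^sub>R e + \<rho> *\<^sub>R u)) \<le> LG * (c * \<bar>\<rho> - s\<bar> ^ Suc p)" .
        moreover have "norm (G (\<mu> *\<^sub>R e + \<rho> *\<^sub>R u) - P \<rho>) \<le> C1 * \<bar>\<rho> - s\<bar> ^ Suc p" using 2 by (intro P) auto
        ultimately have "norm (P' \<rho> - P \<rho>) \<le> LG * (c * \<bar>\<rho> - s\<bar> ^ Suc p) + C1 * \<bar>\<rho> - s\<bar> ^ Suc p"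
          using norm_triangle_ineq[of "P' \<rho> - G (\<mu> *\<^sub>R e + \<rho> *\<^sub>R u)" "G (\<mu> *\<^sub>R e + \<rho> *\<^sub>R u) - P \<rho>"] by simp
        then show "norm (P' \<rho> - P \<rho>) \<le> (LG * c + C1) * \<bar>\<rho> - s\<bar> ^ Suc p" by (simp add: distrib_right mult.assoc)
      qed
      show "v' = v"
      proof (rule polycurve_unique)
        show "v' q = 0" if "q = 0 \<or> p < q" for q using v' that by blast
        show "v q = 0" if "q = 0 \<or> p < q" for q using that by (auto simp: v_def)
      qed (rule close[unfolded P_def P'_def])
    qed
    define W where "W = extrap (\<lambda>z. F z - \<mu> *\<^sub>R e) p w"
    have W: "W = P 0"
      unfolding W_def extrap_def Let_def P_def
      by (simp only: r_def[symmetric] s_def[symmetric] u_def[symmetric] exact)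
    have \<mu>e: "norm (\<mu> *\<^sub>R e) \<le> \<beta>"
    proof -
      have "\<bar>\<mu>\<bar> * norm e \<le> \<delta> * (norm e + 1)" using \<mu> by (intro mult_mono) auto
      then show ?thesis using \<delta>(4) by simp
    qed
    have s0: "s \<ge> 0" by (simp add: s_def)
    have s1: "s ^ Suc p \<le> \<delta>"
    proof -
      have "s \<le> \<delta>" using r by (simp add: s_def r_def)
      moreover have "s ^ Suc p \<le> s ^ 1" using s0 \<open>s \<le> \<delta>\<close> \<delta>(3) by (intro power_decreasing) auto
      ultimately show ?thesis by simp
    qed
    \<comment> \<open>At \<rho> = 0 the exact curve reaches G (\<mu> e), a point of the barrier
      trajectory.\<close>
    have WG: "norm (G (\<mu> *\<^sub>R e) - W) \<le> C1 * s ^ Suc p"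
      using P[of 0] \<mu>e s0 by (simp add: W)
    have Gws: "norm (G (\<mu> *\<^sub>R e) - ws) \<le> LG * norm e * \<bar>\<mu>\<bar>"
      using LG(2)[of "\<mu> *\<^sub>R e" 0] \<mu>e \<beta>(1) by (simp add: G_zero mult_ac)
    have Wws: "norm (W - ws) \<le> C1 * s ^ Suc p + LG * norm e * \<bar>\<mu>\<bar>"
      using WG Gws norm_triangle_ineq[of "W - G (\<mu> *\<^sub>R e)" "G (\<mu> *\<^sub>R e) - ws"]
      by (simp add: norm_minus_commute)
    have LGe: "LG * norm e \<ge> 0" using LG(1) by simp
    have small: "C1 * s ^ Suc p \<le> C1 * \<delta>" "LG * norm e * \<bar>\<mu>\<bar> \<le> LG * norm e * \<delta>"
      using s1 \<mu> C1(1) LGe by (intro mult_left_mono; simp)+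
    have "C1 * \<delta> + LG * norm e * \<delta> \<le> 1" using \<delta>(1,5) by (simp add: algebra_simps)
    moreover have nonneg: "C1 * s ^ Suc p \<ge> 0" "LG * norm e * \<bar>\<mu>\<bar> \<ge> 0" using C1(1) LGe s0 by auto
    ultimately have near: "W \<in> cball ws 1" "G (\<mu> *\<^sub>R e) \<in> cball ws 1"
      using Wws Gws small by (auto simp: dist_norm norm_minus_commute)
    have "norm (F W - \<mu> *\<^sub>R e) = norm (F (G (\<mu> *\<^sub>R e)) - F W)"
      using \<mu>e \<beta>(2) by (subst F_G) (auto simp: norm_minus_commute)
    also have "\<dots> \<le> LF * norm (G (\<mu> *\<^sub>R e) - W)" using near by (intro LF(2))
    also have "\<dots> \<le> LF * (C1 * s ^ Suc p)" using WG LF(1) by (rule mult_left_mono)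
    also have "\<dots> \<le> C * s ^ Suc p"
    proof -
      have "(LF * C1) * s ^ Suc p \<le> C * s ^ Suc p"
        using C1(1) LGe s0 unfolding C_def by (intro mult_right_mono) auto
      then show ?thesis by (simp only: mult.assoc)
    qed
    finally have "norm (F W - \<mu> *\<^sub>R e) \<le> C * s ^ Suc p" .
    moreover have "C1 * s ^ Suc p + LG * norm e * \<bar>\<mu>\<bar> \<le> C * s ^ Suc p + C * \<bar>\<mu>\<bar>"
      using C1(1) LGe LF(1) s0 unfolding C_def by (intro add_mono mult_right_mono) auto
    ultimately show ?thesis
      using Wws by (simp add: W_def s_def r_def distrib_left)
  qed
  have "C \<ge> 0" using C1(1) LG(1) LF(1) by (simp add: C_def)
  from that[OF \<delta>(1) this est] show ?thesis by blast
qed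

section \<open>Derivative of the barrier trajectory\<close>

lemma trajectory_has_vector_derivative:
  assumes "(G has_derivative G') (at 0)"
  shows "((\<lambda>\<mu>. G (\<mu> *\<^sub>R e)) has_vector_derivative G' e) (at 0)"
proof -
  have lin: "linear G'" using assms by (rule has_derivative_linear)
  have "((\<lambda>\<mu>. \<mu> *\<^sub>R e) has_derivative (\<lambda>h. h *\<^sub>R e)) (at (0::real))"
    by (auto intro!: derivative_eq_intros)
  moreover have "(G has_derivative G') (at (0 *\<^sub>R e))" using assms by simp
  ultimately have "((\<lambda>\<mu>. G (\<mu> *\<^sub>R e)) has_derivative (\<lambda>h. G' (h *\<^sub>R e))) (at 0)"
    by (rule has_derivative_compose)
  then show ?thesis by (simp add: has_vector_derivative_def linear_scale[OF lin])
qed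

text \<open>By continuity H (\<mu> e) lies in \<open>U\<close> for small \<mu>, where
  \<open>F\<close> is injective, so \<open>H\<close> and \<open>G\<close> agree along the
  trajectory. This makes the definite description in \<open>traj_deriv0\<close> independent of the
  chosen inverse.\<close>

lemma trajectory_derivative_unique:
  assumes G': "(G has_derivative G') (at 0)"
    and "open U'" "0 \<in> U'" "continuous_on U' H" "H 0 = ws" "\<And>r. r \<in> U' \<Longrightarrow> F (H r) = r"
    and H: "((\<lambda>\<mu>. H (\<mu> *\<^sub>R e)) has_vector_derivative v) (at 0)"
  shows "v = G' e"
proof -
  have "isCont H 0" using assms continuous_on_eq_continuous_at by blast
  moreover have lim: "((\<lambda>\<mu>. \<mu> *\<^sub>R e) \<longlongrightarrow> 0) (at (0::real))"
  proof -
    have "((\<lambda>\<mu>. \<mu> *\<^sub>R e) \<longlongrightarrow> 0 *\<^sub>R e) (at (0::real))" by (intro tendsto_intros)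
    then show ?thesis by simp
  qed
  ultimately have "((\<lambda>\<mu>. H (\<mu> *\<^sub>R e)) \<longlongrightarrow> ws) (at (0::real))"
    using isCont_tendsto_compose \<open>H 0 = ws\<close> by metis
  then have "\<forall>\<^sub>F \<mu> in at (0::real). H (\<mu> *\<^sub>R e) \<in> U"
    by (rule topological_tendstoD[OF _ open_U ws_in_U])
  moreover have "\<forall>\<^sub>F \<mu> in at (0::real). \<mu> *\<^sub>R e \<in> U'"
    by (rule topological_tendstoD[OF lim]) (use assms in auto)
  ultimately have "\<forall>\<^sub>F \<mu> in at (0::real). H (\<mu> *\<^sub>R e) = G (\<mu> *\<^sub>R e)"
    by eventually_elim (metis G_F assms(6))
  moreover have "H (0 *\<^sub>R e) = G (0 *\<^sub>R e)" using \<open>H 0 = ws\<close> G_zero by simp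
  ultimately have "((\<lambda>\<mu>. G (\<mu> *\<^sub>R e)) has_vector_derivative v) (at 0)"
    using H unfolding has_vector_derivative_def
    by (simp add: has_derivative_transform_eventually)
  moreover have "((\<lambda>\<mu>. G (\<mu> *\<^sub>R e)) has_vector_derivative G' e) (at 0)"
    using G' by (rule trajectory_has_vector_derivative)
  ultimately show ?thesis by (rule vector_derivative_unique_at)
qed

end

section \<open>Orders of convergence\<close>

text \<open>The error at index k + 1 is asymptotically \<bar>v\<bar> \<mu> k. As v \<noteq> 0, the
  error also bounds \<mu> k from above, so the recursion of order \<kappa> for \<mu> passes to the
  errors.\<close>

lemma Q_conv_orderI:
  fixes a :: "nat \<Rightarrow> real"
  assumes pos: "\<And>k. \<mu> k > 0" and "\<kappa> > 0"
    and \<mu>: "\<forall>\<^sub>F k in sequentially. \<mu> (Suc k) \<le> c * \<mu> k powr \<kappa>"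
    and a: "a \<longlonglongrightarrow> l" and lim: "(\<lambda>k. (a (Suc k) - l) / \<mu> k) \<longlonglongrightarrow> v" and "v \<noteq> 0"
  shows "Q_conv_order a l \<kappa>"
proof -
  \<comment> \<open>The factors come from the upper bound on the later error, the recursion for
    \<mu>, and the lower bound \<bar>v\<bar> / 2 on the earlier error quotient raised to the power
    \<kappa>.\<close>
  define D where "D = (\<bar>v\<bar> + 1) * c * (2 / \<bar>v\<bar>) powr \<kappa>"
  have lim': "(\<lambda>k. \<bar>a (Suc k) - l\<bar> / \<mu> k) \<longlonglongrightarrow> \<bar>v\<bar>"
    using tendsto_rabs[OF lim] pos by (simp add: abs_divide less_imp_le)
  have upper: "\<forall>\<^sub>F k in sequentially. \<bar>a (Suc (Suc k)) - l\<bar> / \<mu> (Suc k) < \<bar>v\<bar> + 1"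
    using order_tendstoD(2)[OF LIMSEQ_Suc[OF lim'], of "\<bar>v\<bar> + 1"] by simp
  have lower: "\<forall>\<^sub>F k in sequentially. \<bar>v\<bar> / 2 < \<bar>a (Suc k) - l\<bar> / \<mu> k"
    using order_tendstoD(1)[OF lim', of "\<bar>v\<bar> / 2"] \<open>v \<noteq> 0\<close> by simp
  have "\<forall>\<^sub>F k in sequentially. \<bar>a (Suc (Suc k)) - l\<bar> \<le> D * \<bar>a (Suc k) - l\<bar> powr \<kappa>"
    using upper lower \<mu>
  proof eventually_elim
    fix k assume u: "\<bar>a (Suc (Suc k)) - l\<bar> / \<mu> (Suc k) < \<bar>v\<bar> + 1"
      and lo: "\<bar>v\<bar> / 2 < \<bar>a (Suc k) - l\<bar> / \<mu> k" and m: "\<mu> (Suc k) \<le> c * \<mu> k powr \<kappa>"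
    have c: "c \<ge> 0"
    proof (rule ccontr)
      assume "\<not> c \<ge> 0"
      then have "c * \<mu> k powr \<kappa> < 0" using pos[of k] by (simp add: mult_neg_pos)
      then show False using m pos[of "Suc k"] by linarith
    qed
    have "\<mu> k \<le> 2 / \<bar>v\<bar> * \<bar>a (Suc k) - l\<bar>"
    proof -
      have "\<bar>v\<bar> / 2 * \<mu> k < \<bar>a (Suc k) - l\<bar>" using lo pos[of k] by (simp add: pos_less_divide_eq)
      then show ?thesis using \<open>v \<noteq> 0\<close> by (simp add: field_simps)
    qed
    then have "\<mu> k powr \<kappa> \<le> (2 / \<bar>v\<bar> * \<bar>a (Suc k) - l\<bar>) powr \<kappa>"
      using pos[of k] \<open>\<kappa> > 0\<close> by (intro powr_mono2) auto
    also have "\<dots> = (2 / \<bar>v\<bar>) powr \<kappa> * \<bar>a (Suc k) - l\<bar> powr \<kappa>" by (rule powr_mult)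
    finally have le: "\<mu> k powr \<kappa> \<le> (2 / \<bar>v\<bar>) powr \<kappa> * \<bar>a (Suc k) - l\<bar> powr \<kappa>" .
    have "\<bar>a (Suc (Suc k)) - l\<bar> \<le> (\<bar>v\<bar> + 1) * \<mu> (Suc k)"
      using u pos[of "Suc k"] by (simp add: pos_divide_less_eq)
    also have "\<dots> \<le> (\<bar>v\<bar> + 1) * (c * ((2 / \<bar>v\<bar>) powr \<kappa> * \<bar>a (Suc k) - l\<bar> powr \<kappa>))"
      using order_trans[OF m mult_left_mono[OF le c]] by (intro mult_left_mono) auto
    finally show "\<bar>a (Suc (Suc k)) - l\<bar> \<le> D * \<bar>a (Suc k) - l\<bar> powr \<kappa>" by (simp add: D_def mult_ac)
  qed
  then have "\<forall>\<^sub>F k in sequentially. \<bar>a (Suc k) - l\<bar> \<le> D * \<bar>a k - l\<bar> powr \<kappa>"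
    by (subst (asm) eventually_sequentially_Suc)
  with a show ?thesis unfolding Q_conv_order_def by blast
qed

text \<open>Rescaling by \<open>b\<close> absorbs the constant: b \<mu> (k+1) \<le> (b \<mu>
  k)^\<kappa>. Iterating this from an index where b \<mu> < 1 gives the doubly exponential
  decay.\<close>

lemma superlinear_decay:
  fixes \<mu> :: "nat \<Rightarrow> real"
  assumes pos: "\<And>k. \<mu> k > 0" and \<mu>0: "\<mu> \<longlonglongrightarrow> 0" and "\<kappa> > 1"
    and \<mu>: "\<forall>\<^sub>F k in sequentially. \<mu> (Suc k) \<le> c * \<mu> k powr \<kappa>"
  shows "\<exists>C \<theta>. C > 0 \<and> 0 < \<theta> \<and> \<theta> < 1 \<and> (\<forall>\<^sub>F k in sequentially. \<mu> k \<le> C * \<theta> powr (\<kappa> ^ k))"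
proof -
  \<comment> \<open>The exponent is chosen so that b^\<kappa> = b max c 1; the maximum with 1
    ensures b > 0.\<close>
  define b where "b = max c 1 powr (1 / (\<kappa> - 1))"
  have b: "b > 0" by (simp add: b_def)
  have "b powr (\<kappa> - 1) = max c 1" using \<open>\<kappa> > 1\<close> by (simp add: b_def powr_powr)
  then have b\<kappa>: "b powr \<kappa> = b * max c 1"
    using b powr_add[of b 1 "\<kappa> - 1"] by simp
  have "(\<lambda>k. b * \<mu> k) \<longlonglongrightarrow> 0" by (intro tendsto_mult_right_zero \<mu>0)
  from order_tendstoD(2)[OF this, of 1] \<mu>
  have "\<forall>\<^sub>F k in sequentially. b * \<mu> k < 1 \<and> \<mu> (Suc k) \<le> c * \<mu> k powr \<kappa>"
    by (simp add: eventually_conj)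
  then obtain N where N: "\<And>k. k \<ge> N \<Longrightarrow> b * \<mu> k < 1 \<and> \<mu> (Suc k) \<le> c * \<mu> k powr \<kappa>"
    unfolding eventually_sequentially by blast
  have step: "b * \<mu> (Suc k) \<le> (b * \<mu> k) powr \<kappa>" if "k \<ge> N" for k
  proof -
    have "\<mu> (Suc k) \<le> max c 1 * \<mu> k powr \<kappa>"
      using N[OF that] mult_right_mono[of c "max c 1" "\<mu> k powr \<kappa>"] by simp
    then have "b * \<mu> (Suc k) \<le> b * (max c 1 * \<mu> k powr \<kappa>)" using b by simp
    also have "\<dots> = (b * \<mu> k) powr \<kappa>" using b pos[of k] by (simp add: powr_mult b\<kappa> mult.assoc)
    finally show ?thesis .
  qed
  \<comment> \<open>The root of order \<kappa>^N makes \<theta> powr \<kappa>^N equal to b \<mu> N,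
    so that the bound is in terms of \<kappa>^k and not \<kappa>^(k-N).\<close>
  define \<theta> where "\<theta> = (b * \<mu> N) powr (1 / \<kappa> ^ N)"
  have q: "b * \<mu> N > 0" using b pos by simp
  have \<kappa>N: "\<kappa> ^ N > 0" using \<open>\<kappa> > 1\<close> by simp
  have "\<theta> > 0" using b pos[of N] by (simp add: \<theta>_def)
  moreover have "\<theta> < 1" using q N[of N] \<kappa>N powr_less_mono2[of "1 / \<kappa> ^ N" "b * \<mu> N" 1] by (simp add: \<theta>_def)
  moreover have decay: "b * \<mu> (N + j) \<le> \<theta> powr (\<kappa> ^ (N + j))" for j
  proof (induction j)
    case 0
    have "\<theta> powr (\<kappa> ^ N) = b * \<mu> N" using less_imp_le[OF q] \<open>\<kappa> > 1\<close> by (simp add: \<theta>_def powr_powr)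
    then show ?case by simp
  next
    case (Suc j)
    have "b * \<mu> (N + Suc j) \<le> (b * \<mu> (N + j)) powr \<kappa>" using step[of "N + j"] by simp
    also have "\<dots> \<le> (\<theta> powr (\<kappa> ^ (N + j))) powr \<kappa>"
      using Suc b pos[of "N + j"] \<open>\<kappa> > 1\<close> by (intro powr_mono2) auto
    also have "\<dots> = \<theta> powr (\<kappa> ^ (N + Suc j))" by (simp add: powr_powr mult.commute)
    finally show ?case .
  qed
  then have "\<mu> k \<le> (1 / b) * \<theta> powr (\<kappa> ^ k)" if "k \<ge> N" for k
  proof -
    obtain j where "k = N + j" using \<open>k \<ge> N\<close> le_Suc_ex by blast
    then have "b * \<mu> k \<le> \<theta> powr (\<kappa> ^ k)" using decay by simp
    then show ?thesis using b by (simp add: pos_le_divide_eq mult.commute)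
  qed
  then have "\<forall>\<^sub>F k in sequentially. \<mu> k \<le> (1 / b) * \<theta> powr (\<kappa> ^ k)"
    unfolding eventually_sequentially by blast
  ultimately show ?thesis using b by (intro exI[of _ "1 / b"] exI[of _ \<theta>]) auto
qed

lemma R_conv_orderI:
  fixes a :: "nat \<Rightarrow> real"
  assumes pos: "\<And>k. \<mu> k > 0" and \<mu>0: "\<mu> \<longlonglongrightarrow> 0" and "\<kappa> > 1"
    and \<mu>: "\<forall>\<^sub>F k in sequentially. \<mu> (Suc k) \<le> c * \<mu> k powr \<kappa>"
    and a: "a \<longlonglongrightarrow> l" and lim: "(\<lambda>k. (a (Suc k) - l) / \<mu> k) \<longlonglongrightarrow> v"
  shows "R_conv_order a l \<kappa>"
proof -
  obtain C \<theta> where C: "C > 0" "0 < \<theta>" "\<theta> < 1" "\<forall>\<^sub>F k in sequentially. \<mu> k \<le> C * \<theta> powr (\<kappa> ^ k)"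
    using superlinear_decay[OF pos \<mu>0 \<open>\<kappa> > 1\<close> \<mu>] by blast
  have "(\<lambda>k. \<bar>a (Suc k) - l\<bar> / \<mu> k) \<longlonglongrightarrow> \<bar>v\<bar>"
    using tendsto_rabs[OF lim] pos by (simp add: abs_divide less_imp_le)
  from order_tendstoD(2)[OF this, of "\<bar>v\<bar> + 1"]
  have "\<forall>\<^sub>F k in sequentially. \<bar>a (Suc k) - l\<bar> / \<mu> k < \<bar>v\<bar> + 1" by simp
  then have "\<forall>\<^sub>F k in sequentially. \<bar>a (Suc k) - l\<bar> \<le> (\<bar>v\<bar> + 1) * C * (\<theta> powr (1 / \<kappa>)) powr (\<kappa> ^ Suc k)"
    using C(4)
  proof eventually_elim
    fix k assume 1: "\<bar>a (Suc k) - l\<bar> / \<mu> k < \<bar>v\<bar> + 1" and 2: "\<mu> k \<le> C * \<theta> powr (\<kappa> ^ k)"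
    have "\<bar>a (Suc k) - l\<bar> \<le> (\<bar>v\<bar> + 1) * \<mu> k" using 1 pos[of k] by (simp add: pos_divide_less_eq)
    also have "\<dots> \<le> (\<bar>v\<bar> + 1) * (C * \<theta> powr (\<kappa> ^ k))" using 2 by (intro mult_left_mono) auto
    \<comment> \<open>The error at k + 1 is controlled by \<mu> k, one index behind; replacing
      \<theta> by its root of order \<kappa> makes up for this.\<close>
    also have "\<theta> powr (\<kappa> ^ k) = (\<theta> powr (1 / \<kappa>)) powr (\<kappa> ^ Suc k)"
      using \<open>\<kappa> > 1\<close> by (simp add: powr_powr)
    finally show "\<bar>a (Suc k) - l\<bar> \<le> (\<bar>v\<bar> + 1) * C * (\<theta> powr (1 / \<kappa>)) powr (\<kappa> ^ Suc k)"
      by (simp only: mult.assoc)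
  qed
  then have "\<forall>\<^sub>F k in sequentially. \<bar>a k - l\<bar> \<le> (\<bar>v\<bar> + 1) * C * (\<theta> powr (1 / \<kappa>)) powr (\<kappa> ^ k)"
    by (subst (asm) eventually_sequentially_Suc)
  moreover have "0 < \<theta> powr (1 / \<kappa>)" "\<theta> powr (1 / \<kappa>) < 1"
    using C(2,3) \<open>\<kappa> > 1\<close> powr_less_mono2[of "1 / \<kappa>" \<theta> 1] by auto
  ultimately show ?thesis using a unfolding R_conv_order_def by blast
qed

section \<open>Convergence of the iterates\<close>

context smooth_local_inverse
begin

text \<open>The hypotheses \<open>test\<close> and \<open>res\<close> record what is known of the
  inner method, and \<open>wb\<close> is an extrapolation only near \<open>ws\<close>. The
  subsequence supplies one late iterate inside a small ball; invariance of that ball under the step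
  does the rest.\<close>

proposition extrapolation_iterates:
  fixes w wb :: "nat \<Rightarrow> 'a" and \<mu> \<epsilon> :: "nat \<Rightarrow> real" and \<sigma> :: "nat \<Rightarrow> nat"
  assumes pos: "\<And>k. \<mu> k > 0" and \<mu>0: "\<mu> \<longlonglongrightarrow> 0" and \<kappa>: "1 < \<kappa>" "\<kappa> < real p + 1"
    and c: "c1 > 0" "c3 > 0"
    and \<epsilon>: "\<forall>\<^sub>F k in sequentially. c1 * \<mu> k \<le> \<epsilon> k \<and> \<epsilon> k \<le> c2 * \<mu> k"
    and \<mu>: "\<forall>\<^sub>F k in sequentially. c3 * \<mu> k powr \<kappa> \<le> \<mu> (Suc k) \<and> \<mu> (Suc k) \<le> c4 * \<mu> k powr \<kappa>"
    and wb: "\<delta>0 > 0" "\<And>k. norm (w k - ws) < \<delta>0 \<Longrightarrow> wb k = extrap (\<lambda>z. F z - \<mu> k *\<^sub>R e) p (w k)"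
    and test: "\<And>k. norm (F (wb k) - \<mu> k *\<^sub>R e) \<le> \<epsilon> k \<Longrightarrow> w (Suc k) = wb k"
    and res: "\<And>k. norm (F (w (Suc k)) - \<mu> k *\<^sub>R e) \<le> \<epsilon> k"
    and \<sigma>: "strict_mono \<sigma>" "(\<lambda>i. w (Suc (\<sigma> i))) \<longlonglongrightarrow> ws"
    and G': "(G has_derivative G') (at 0)"
  shows "w \<longlonglongrightarrow> ws"
    and "\<forall>\<^sub>F k in sequentially. norm (F (wb k) - \<mu> k *\<^sub>R e) \<le> \<epsilon> k \<and> w (Suc k) = wb k"
    and "(\<lambda>k. (w (Suc k) - ws) /\<^sub>R \<mu> k) \<longlonglongrightarrow> G' e"
proof -
  obtain \<delta>' C where \<delta>': "\<delta>' > 0" and C: "C \<ge> 0" and est: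
    "\<And>w \<mu>. norm (w - ws) < \<delta>' \<Longrightarrow> \<bar>\<mu>\<bar> < \<delta>' \<Longrightarrow> norm (F w - \<mu> *\<^sub>R e) < \<delta>' \<Longrightarrow>
       norm (F (extrap (\<lambda>z. F z - \<mu> *\<^sub>R e) p w) - \<mu> *\<^sub>R e) \<le> C * norm (F w - \<mu> *\<^sub>R e) ^ Suc p \<and>
       norm (extrap (\<lambda>z. F z - \<mu> *\<^sub>R e) p w - ws) \<le> C * (norm (F w - \<mu> *\<^sub>R e) ^ Suc p + \<bar>\<mu>\<bar>)"
    using extrap_estimate[of e] by metis
  define \<delta> where "\<delta> = min \<delta>' \<delta>0"
  have \<delta>: "\<delta> > 0" "\<delta> \<le> \<delta>'" "\<delta> \<le> \<delta>0" using \<delta>' wb(1) by (auto simp: \<delta>_def)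
  have \<mu>_Suc0: "(\<lambda>k. \<mu> (Suc k)) \<longlonglongrightarrow> 0" using LIMSEQ_Suc[OF \<mu>0] .
  have powr0: "(\<lambda>k. \<mu> k powr \<alpha>) \<longlonglongrightarrow> 0" if "\<alpha> > 0" for \<alpha>
    using tendsto_zero_powrI[OF \<mu>0 tendsto_const _ that] pos by (simp add: less_imp_le)
  have decr: "\<forall>\<^sub>F k in sequentially. \<mu> (Suc k) \<le> \<mu> k"
  proof -
    have "(\<lambda>k. c4 * \<mu> k powr (\<kappa> - 1)) \<longlonglongrightarrow> 0"
      using \<kappa> by (intro tendsto_mult_right_zero powr0) simp
    from order_tendstoD(2)[OF this, of 1] have "\<forall>\<^sub>F k in sequentially. c4 * \<mu> k powr (\<kappa> - 1) < 1" by simp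
    then show ?thesis using \<mu>
    proof eventually_elim
      fix k assume 1: "c4 * \<mu> k powr (\<kappa> - 1) < 1"
        and 2: "c3 * \<mu> k powr \<kappa> \<le> \<mu> (Suc k) \<and> \<mu> (Suc k) \<le> c4 * \<mu> k powr \<kappa>"
      have "c4 * \<mu> k powr \<kappa> = (c4 * \<mu> k powr (\<kappa> - 1)) * \<mu> k"
        using pos[of k] powr_add[of "\<mu> k" "\<kappa> - 1" 1] by simp
      also have "\<dots> \<le> 1 * \<mu> k" using 1 pos[of k] by (intro mult_right_mono) auto
      finally show "\<mu> (Suc k) \<le> \<mu> k" using 2 by simp
    qed
  qed
  \<comment> \<open>\<open>s k\<close> is the residual of iterate k + 1 for its own parameter \<mu>
    (k+1), whereas the stopping test controls it for \<mu> k. The first term of \<open>D\<close>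
    comes from the test, the second from the change of parameter.\<close>
  define D where "D = \<bar>c2\<bar> + 2 * norm e"
  define s where "s k = norm (F (w (Suc k)) - \<mu> (Suc k) *\<^sub>R e)" for k
  have s: "\<forall>\<^sub>F k in sequentially. s k \<le> D * \<mu> k"
    using decr \<epsilon>
  proof eventually_elim
    fix k assume 1: "\<mu> (Suc k) \<le> \<mu> k" and 2: "c1 * \<mu> k \<le> \<epsilon> k \<and> \<epsilon> k \<le> c2 * \<mu> k"
    have "F (w (Suc k)) - \<mu> (Suc k) *\<^sub>R e = (F (w (Suc k)) - \<mu> k *\<^sub>R e) + (\<mu> k - \<mu> (Suc k)) *\<^sub>R e"
      by (simp add: algebra_simps)
    then have "s k \<le> norm (F (w (Suc k)) - \<mu> k *\<^sub>R e) + \<bar>\<mu> k - \<mu> (Suc k)\<bar> * norm e"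
      unfolding s_def by (metis norm_triangle_ineq norm_scaleR)
    also have "\<dots> \<le> \<bar>c2\<bar> * \<mu> k + (2 * \<mu> k) * norm e"
    proof (intro add_mono mult_right_mono)
      have "c2 * \<mu> k \<le> \<bar>c2\<bar> * \<mu> k" using pos[of k] by (intro mult_right_mono) auto
      then show "norm (F (w (Suc k)) - \<mu> k *\<^sub>R e) \<le> \<bar>c2\<bar> * \<mu> k" using res[of k] 2 by linarith
      show "\<bar>\<mu> k - \<mu> (Suc k)\<bar> \<le> 2 * \<mu> k" using 1 pos[of k] pos[of "Suc k"] by linarith
    qed auto
    finally show "s k \<le> D * \<mu> k" by (simp add: D_def algebra_simps)
  qed
  \<comment> \<open>\<open>\<tau> k\<close> bounds the residual after one extrapolation. Division by
    \<mu> (k+1) \<ge> c3 \<mu> k^\<kappa> leaves a multiple of \<mu> k^(p+1-\<kappa>), which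
    vanishes in the limit because \<kappa> < p + 1.\<close>
  define \<tau> where "\<tau> k = C * (D * \<mu> k) ^ Suc p" for k
  have D0: "D \<ge> 0" by (simp add: D_def)
  have \<tau>: "(\<lambda>k. \<tau> k / \<mu> (Suc k)) \<longlonglongrightarrow> 0"
  proof (rule tendsto_sandwich)
    show "\<forall>\<^sub>F k in sequentially. 0 \<le> \<tau> k / \<mu> (Suc k)"
      using C D0 pos by (auto simp: \<tau>_def less_imp_le intro!: always_eventually)
    show "(\<lambda>k. C * D ^ Suc p / c3 * \<mu> k powr (real p + 1 - \<kappa>)) \<longlonglongrightarrow> 0"
      using \<kappa> by (intro tendsto_mult_right_zero powr0) simp
    show "\<forall>\<^sub>F k in sequentially. \<tau> k / \<mu> (Suc k) \<le> C * D ^ Suc p / c3 * \<mu> k powr (real p + 1 - \<kappa>)"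
      using \<mu>
    proof eventually_elim
      fix k assume 2: "c3 * \<mu> k powr \<kappa> \<le> \<mu> (Suc k) \<and> \<mu> (Suc k) \<le> c4 * \<mu> k powr \<kappa>"
      have "\<mu> k powr (real p + 1) = \<mu> k ^ Suc p"
        using powr_realpow[OF pos[of k], of "Suc p"] by (simp add: add.commute)
      moreover have "\<mu> k powr (real p + 1) = \<mu> k powr (real p + 1 - \<kappa>) * \<mu> k powr \<kappa>"
        using powr_add[of "\<mu> k" "real p + 1 - \<kappa>" \<kappa>] by simp
      ultimately have \<tau>_eq: "\<tau> k = C * D ^ Suc p * (\<mu> k powr (real p + 1 - \<kappa>) * \<mu> k powr \<kappa>)"
        by (simp only: \<tau>_def power_mult_distrib mult.assoc)
      have "\<tau> k / \<mu> (Suc k) \<le> \<tau> k / (c3 * \<mu> k powr \<kappa>)"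
        using 2 c C D0 pos[of k] pos[of "Suc k"]
        by (intro divide_left_mono) (auto simp: \<tau>_def less_imp_le intro!: mult_pos_pos)
      also have "\<dots> = C * D ^ Suc p / c3 * \<mu> k powr (real p + 1 - \<kappa>)"
        unfolding \<tau>_eq using pos[of k] by simp
      finally show "\<tau> k / \<mu> (Suc k) \<le> C * D ^ Suc p / c3 * \<mu> k powr (real p + 1 - \<kappa>)" .
    qed
  qed auto
  have \<tau>_le: "\<forall>\<^sub>F k in sequentially. \<tau> k \<le> c1 * \<mu> (Suc k)"
    using order_tendstoD(2)[OF \<tau> c(1)]
    by eventually_elim (use pos in \<open>simp add: pos_divide_less_eq less_imp_le\<close>)
  define b where "b k = C * ((D * \<mu> k) ^ Suc p + \<mu> (Suc k))" for k
  have b: "b \<longlonglongrightarrow> 0"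
  proof -
    have "b \<longlonglongrightarrow> C * ((D * 0) ^ Suc p + 0)" unfolding b_def by (intro tendsto_intros \<mu>0 \<mu>_Suc0)
    then show ?thesis by simp
  qed
  have D\<mu>: "(\<lambda>k. D * \<mu> k) \<longlonglongrightarrow> 0" by (intro tendsto_mult_right_zero \<mu>0)
  \<comment> \<open>This collects what one accepted extrapolation from iterate k + 1 yields.
    Together, the bound \<open>b k\<close> on the new distance and \<open>b k < \<delta>\<close> put
    the new iterate back into the ball.\<close>
  define good where "good k \<longleftrightarrow> norm (F (wb (Suc k)) - \<mu> (Suc k) *\<^sub>R e) \<le> \<epsilon> (Suc k) \<and>
      w (Suc (Suc k)) = wb (Suc k) \<and> norm (w (Suc (Suc k)) - ws) \<le> b k \<and>
      norm (F (w (Suc (Suc k))) - \<mu> (Suc k) *\<^sub>R e) \<le> \<tau> k \<and> b k < \<delta>" for k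
  have "\<forall>\<^sub>F k in sequentially. norm (w (Suc k) - ws) < \<delta> \<longrightarrow> good k"
    using s \<tau>_le sequentially_offset[OF \<epsilon>, of 1] order_tendstoD(2)[OF b \<delta>(1)]
      order_tendstoD(2)[OF D\<mu> \<delta>(1)] order_tendstoD(2)[OF \<mu>_Suc0 \<delta>(1)]
  proof (eventually_elim, intro impI)
    fix k assume s: "s k \<le> D * \<mu> k" and \<tau>: "\<tau> k \<le> c1 * \<mu> (Suc k)"
      and \<epsilon>: "c1 * \<mu> (k + 1) \<le> \<epsilon> (k + 1) \<and> \<epsilon> (k + 1) \<le> c2 * \<mu> (k + 1)"
      and b: "b k < \<delta>" and D: "D * \<mu> k < \<delta>" and m: "\<mu> (Suc k) < \<delta>" and w: "norm (w (Suc k) - ws) < \<delta>"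
    have wb_eq: "wb (Suc k) = extrap (\<lambda>z. F z - \<mu> (Suc k) *\<^sub>R e) p (w (Suc k))"
      using w \<delta>(3) by (intro wb(2)) simp
    have "norm (w (Suc k) - ws) < \<delta>'" "\<bar>\<mu> (Suc k)\<bar> < \<delta>'" "norm (F (w (Suc k)) - \<mu> (Suc k) *\<^sub>R e) < \<delta>'"
      using w m D s pos[of "Suc k"] \<delta>(2) by (auto simp: s_def)
    from est[OF this, folded wb_eq s_def]
    have e: "norm (F (wb (Suc k)) - \<mu> (Suc k) *\<^sub>R e) \<le> C * s k ^ Suc p"
      "norm (wb (Suc k) - ws) \<le> C * (s k ^ Suc p + \<bar>\<mu> (Suc k)\<bar>)" by blast+
    have s_pow: "s k ^ Suc p \<le> (D * \<mu> k) ^ Suc p" using s by (intro power_mono) (auto simp: s_def)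
    have 1: "norm (F (wb (Suc k)) - \<mu> (Suc k) *\<^sub>R e) \<le> \<tau> k"
      using e(1) mult_left_mono[OF s_pow C] by (simp only: \<tau>_def)
    have 2: "norm (wb (Suc k) - ws) \<le> b k"
    proof -
      have "C * (s k ^ Suc p + \<bar>\<mu> (Suc k)\<bar>) \<le> b k"
        unfolding b_def using s_pow pos[of "Suc k"] C by (intro mult_left_mono) auto
      then show ?thesis using e(2) by simp
    qed
    have 3: "norm (F (wb (Suc k)) - \<mu> (Suc k) *\<^sub>R e) \<le> \<epsilon> (Suc k)" using 1 \<tau> \<epsilon> by simp
    then have "w (Suc (Suc k)) = wb (Suc k)" by (rule test)
    then show "good k" unfolding good_def using 1 2 3 b by simp
  qed
  then obtain N where N: "\<And>k. k \<ge> N \<Longrightarrow> norm (w (Suc k) - ws) < \<delta> \<Longrightarrow> good k"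
    unfolding eventually_sequentially by blast
  have "\<forall>\<^sub>F i in sequentially. dist (w (Suc (\<sigma> i))) ws < \<delta>" using tendstoD[OF \<sigma>(2) \<delta>(1)] .
  moreover have "\<forall>\<^sub>F i in sequentially. i \<ge> N" by (rule eventually_ge_at_top)
  ultimately have "\<forall>\<^sub>F i in sequentially. dist (w (Suc (\<sigma> i))) ws < \<delta> \<and> i \<ge> N" by (rule eventually_conj)
  then obtain i where i: "dist (w (Suc (\<sigma> i))) ws < \<delta>" "i \<ge> N"
    using eventually_happens'[OF sequentially_bot] by blast
  have \<sigma>N: "\<sigma> i \<ge> N" using i(2) strict_mono_imp_increasing[OF \<sigma>(1), of i] by simp
  \<comment> \<open>The iterates cannot leave the ball once one of index beyond \<open>N\<close> has
    entered it.\<close>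
  have near: "norm (w (Suc k) - ws) < \<delta>" if "k \<ge> \<sigma> i" for k
    using that
  proof (induction k rule: dec_induct)
    case base
    then show ?case using i(1) by (simp add: dist_norm)
  next
    case (step k)
    then have "good k" using \<sigma>N by (intro N) auto
    then show ?case by (auto simp: good_def)
  qed
  have good: "\<forall>\<^sub>F k in sequentially. good k"
    unfolding eventually_sequentially using N near \<sigma>N by (meson order_trans)
  then have "\<forall>\<^sub>F k in sequentially. norm (F (wb (Suc k)) - \<mu> (Suc k) *\<^sub>R e) \<le> \<epsilon> (Suc k) \<and> w (Suc (Suc k)) = wb (Suc k)"
    by eventually_elim (simp add: good_def)
  then show "\<forall>\<^sub>F k in sequentially. norm (F (wb k) - \<mu> k *\<^sub>R e) \<le> \<epsilon> k \<and> w (Suc k) = wb k"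
    by (subst (asm) eventually_sequentially_Suc)
  have "\<forall>\<^sub>F k in sequentially. norm (w (Suc (Suc k)) - ws) \<le> b k"
    using good unfolding good_def by (rule eventually_mono) blast
  then have "(\<lambda>k. w (Suc (Suc k)) - ws) \<longlonglongrightarrow> 0" by (rule Lim_null_comparison) (rule b)
  then have w2: "(\<lambda>k. w (Suc (Suc k))) \<longlonglongrightarrow> ws" by (rule LIM_zero_cancel)
  then show "w \<longlonglongrightarrow> ws"
    by (intro LIMSEQ_imp_Suc[of w] LIMSEQ_imp_Suc[of "\<lambda>k. w (Suc k)"])
  \<comment> \<open>The residual is o(\<mu>), so F w / \<mu> tends to \<open>e\<close>; applying the
    differentiable inverse \<open>G\<close> gives the limit of the error quotient.\<close>
  have "(\<lambda>k. (F (w (Suc (Suc k))) - \<mu> (Suc k) *\<^sub>R e) /\<^sub>R \<mu> (Suc k)) \<longlonglongrightarrow> 0"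
  proof (rule Lim_null_comparison[OF _ \<tau>])
    show "\<forall>\<^sub>F k in sequentially. norm ((F (w (Suc (Suc k))) - \<mu> (Suc k) *\<^sub>R e) /\<^sub>R \<mu> (Suc k)) \<le> \<tau> k / \<mu> (Suc k)"
      using good
    proof eventually_elim
      fix k assume "good k"
      then have "norm (F (w (Suc (Suc k))) - \<mu> (Suc k) *\<^sub>R e) \<le> \<tau> k" unfolding good_def by blast
      then show "norm ((F (w (Suc (Suc k))) - \<mu> (Suc k) *\<^sub>R e) /\<^sub>R \<mu> (Suc k)) \<le> \<tau> k / \<mu> (Suc k)"
        using pos[of "Suc k"] divide_right_mono[of _ "\<tau> k" "\<mu> (Suc k)"]
        by (simp add: divide_inverse mult.commute less_imp_le)
    qed
  qed
  then have "(\<lambda>k. (F (w (Suc (Suc k))) - \<mu> (Suc k) *\<^sub>R e) /\<^sub>R \<mu> (Suc k) + e) \<longlonglongrightarrow> 0 + e"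
    by (intro tendsto_intros)
  moreover have "(F (w (Suc (Suc k))) - \<mu> (Suc k) *\<^sub>R e) /\<^sub>R \<mu> (Suc k) + e = (F (w (Suc (Suc k))) - 0) /\<^sub>R \<mu> (Suc k)" for k
    using pos[of "Suc k"] by (simp add: scaleR_diff_right)
  ultimately have "(\<lambda>k. (F (w (Suc (Suc k))) - 0) /\<^sub>R \<mu> (Suc k)) \<longlonglongrightarrow> e" by simp
  then have "(\<lambda>k. (G (F (w (Suc (Suc k)))) - G 0) /\<^sub>R \<mu> (Suc k)) \<longlonglongrightarrow> G' e"
    by (rule has_derivative_difference_quotient_LIMSEQ[OF G' pos \<mu>_Suc0])
  moreover have "\<forall>\<^sub>F k in sequentially. (G (F (w (Suc (Suc k)))) - G 0) /\<^sub>R \<mu> (Suc k) = (w (Suc (Suc k)) - ws) /\<^sub>R \<mu> (Suc k)"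
    using topological_tendstoD[OF w2 open_U ws_in_U] by eventually_elim (simp add: G_F G_zero)
  ultimately have "(\<lambda>k. (w (Suc (Suc k)) - ws) /\<^sub>R \<mu> (Suc k)) \<longlonglongrightarrow> G' e"
    by (rule Lim_transform_eventually)
  then show "(\<lambda>k. (w (Suc k) - ws) /\<^sub>R \<mu> k) \<longlonglongrightarrow> G' e"
    by (rule LIMSEQ_imp_Suc)
qed

end

section \<open>The primal-dual equations\<close>

lemma Ck_imp_has_derivative:
  assumes "Ck (Suc k) f"
  shows "(f has_derivative frechet_derivative f (at x)) (at x)"
proof -
  obtain f' where "\<And>x. (f has_derivative f' x) (at x)" using assms by auto
  then have "f differentiable (at x)" using differentiable_def by blast
  then show ?thesis using frechet_derivative_works by blast
qed

lemma Ck_on_frechet_derivative: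
  assumes "Ck (Suc k) f"
  shows "Ck_on k UNIV (\<lambda>x. frechet_derivative f (at x) h)"
proof -
  obtain f' where f': "\<And>x. (f has_derivative f' x) (at x)" "\<And>h. Ck k (\<lambda>x. f' x h)"
    using assms by auto
  have "frechet_derivative f (at x) = f' x" for x
    using f'(1) frechet_derivative_at by metis
  then show ?thesis using f'(2) by (simp add: Ck_iff_Ck_on)
qed

lemma Ck_on_grad:
  assumes "Ck (Suc k) f" shows "Ck_on k UNIV (\<lambda>x. grad f x $ j)"
  using Ck_on_frechet_derivative[OF assms] by (simp add: grad_def)

lemma frechet_derivative_eq_grad:
  fixes f :: "real^'n \<Rightarrow> real"
  assumes "f differentiable (at x)"
  shows "frechet_derivative f (at x) h = grad f x \<bullet> h"
proof -
  have "linear (frechet_derivative f (at x))"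
    using assms linear_frechet_derivative by blast
  then have "frechet_derivative f (at x) h = (\<Sum>j\<in>UNIV. h $ j *\<^sub>R frechet_derivative f (at x) (axis j 1))"
    by (subst basis_expansion[of h, symmetric], simp add: linear_sum linear_scale scalar_mult_eq_scaleR)
  then show ?thesis by (simp add: inner_vec_def grad_def mult.commute)
qed

lemma Ck_on_vec_lambda:
  fixes g :: "'i::finite \<Rightarrow> 'a::real_normed_vector \<Rightarrow> real"
  assumes "\<And>i. Ck_on k U (g i)"
  shows "Ck_on k U (\<lambda>x. \<chi> i. g i x)"
proof -
  have "(\<lambda>x. \<chi> i. g i x) = (\<lambda>x. \<Sum>i\<in>UNIV. g i x *\<^sub>R axis i 1)"
    by (simp add: vec_eq_iff fun_eq_iff axis_def if_distrib sum.delta cong: if_cong)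
  then show ?thesis by (simp add: Ck_on_sum Ck_on_scaleR Ck_on_const assms)
qed

lemma Ck_on_Pair:
  assumes "Ck_on k U f" "Ck_on k U g"
  shows "Ck_on k U (\<lambda>x. (f x, g x))"
proof -
  have "Ck_on k U (\<lambda>x. (f x, 0) + (0, g x))"
    by (intro Ck_on_add Ck_on_bounded_linear[OF _ assms(1)] Ck_on_bounded_linear[OF _ assms(2)]
        bounded_linear_Pair bounded_linear_ident bounded_linear_zero)
  then show ?thesis by simp
qed

lemma Ck_on_fst_compose:
  fixes f :: "'a::euclidean_space \<Rightarrow> 'c::real_normed_vector"
  assumes "Ck_on k UNIV f"
  shows "Ck_on k UNIV (\<lambda>z :: 'a \<times> 'b::real_normed_vector. f (fst z))"
  by (intro Ck_on_compose[OF assms] Ck_on_bounded_linear[OF bounded_linear_fst] Ck_on_id) simp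

lemma Ck_on_snd_nth: "Ck_on k U (\<lambda>z :: 'a::real_normed_vector \<times> (real^'m). snd z $ i)"
  by (intro Ck_on_bounded_linear[OF bounded_linear_compose[OF bounded_linear_vec_nth bounded_linear_snd]] Ck_on_id)

text \<open>In coordinates every component is built by sums and products from partial derivatives,
  constraint values and multipliers; the partial derivatives cost one order of smoothness.\<close>

lemma Ck_on_Fmu:
  fixes f :: "real^'n \<Rightarrow> real" and c :: "real^'n \<Rightarrow> real^'m"
  assumes f: "Ck (Suc k) f" and c: "\<And>i. Ck (Suc k) (\<lambda>x. c x $ i)"
  shows "Ck_on k UNIV (Fmu f c I 0)"
proof -
  have "Fmu f c I 0 = (\<lambda>z. (\<chi> j. grad f (fst z) $ j - (\<Sum>i\<in>UNIV. grad (\<lambda>y. c y $ i) (fst z) $ j * snd z $ i),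
      \<chi> i. if i \<in> I then c (fst z) $ i * snd z $ i else c (fst z) $ i))"
    by (auto simp: fun_eq_iff Fmu_def vec_eq_iff matrix_vector_mult_def transpose_def jac_def)
  moreover have ci: "Ck_on k UNIV (\<lambda>x. c x $ i)" for i
    using Ck_on_SucD c by (auto simp: Ck_iff_Ck_on simp del: Ck_on.simps)
  have "Ck_on k UNIV (\<lambda>z :: (real^'n) \<times> (real^'m). if i \<in> I then c (fst z) $ i * snd z $ i else c (fst z) $ i)" for i
    by (cases "i \<in> I") (simp_all add: Ck_on_mult Ck_on_snd_nth Ck_on_fst_compose[OF ci])
  ultimately show ?thesis
    by (simp only:) (intro Ck_on_Pair Ck_on_vec_lambda Ck_on_diff Ck_on_sum Ck_on_mult Ck_on_snd_nth
        Ck_on_fst_compose Ck_on_grad f c)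
qed

section \<open>The Jacobian at a KKT point\<close>

lemma Fmu_eq_shift: "Fmu f c I \<mu> z = Fmu f c I 0 z - \<mu> *\<^sub>R rvec I 1"
  by (cases z) (auto simp: Fmu_def rvec_def vec_eq_iff)

lemma rvec_eq_scaleR: "rvec I \<mu> = \<mu> *\<^sub>R rvec I 1"
  by (auto simp: rvec_def vec_eq_iff)

lemma Fmu_KKT: "is_KKT_mult f c I x l \<Longrightarrow> Fmu f c I 0 (x, l) = 0"
  by (auto simp: is_KKT_mult_def Fmu_def zero_prod_def vec_eq_iff mult.commute)

text \<open>F is affine in the multipliers, so its restriction to a line in a dual direction equals
  its own first-order expansion.\<close>

lemma Fmu_derivative_dual:
  fixes f :: "real^'n \<Rightarrow> real" and c :: "real^'n \<Rightarrow> real^'m"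
  assumes F': "(Fmu f c I 0 has_derivative F') (at (x, l))"
  shows "F' (0, b) = (- (transpose (jac c x) *v b), \<chi> i. if i \<in> I then c x $ i * b $ i else 0)"
proof -
  have "((\<lambda>t. (x, l + t *\<^sub>R b)) has_derivative (\<lambda>t. (0, t *\<^sub>R b))) (at (0::real))"
    by (auto intro!: derivative_eq_intros)
  moreover have "(Fmu f c I 0 has_derivative F') (at (x, l + 0 *\<^sub>R b))" using F' by simp
  ultimately have "((\<lambda>t. Fmu f c I 0 (x, l + t *\<^sub>R b)) has_derivative (\<lambda>t. F' (0, t *\<^sub>R b))) (at 0)"
    by (rule has_derivative_compose)
  moreover define r where "r = (- (transpose (jac c x) *v b), \<chi> i. if i \<in> I then c x $ i * b $ i else 0)"
  have "(\<lambda>t. Fmu f c I 0 (x, l + t *\<^sub>R b)) = (\<lambda>t. Fmu f c I 0 (x, l) + t *\<^sub>R r)"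
    by (auto simp: r_def Fmu_def vec_eq_iff fun_eq_iff matrix_vector_mult_def algebra_simps sum.distrib
        sum_distrib_left)
  ultimately have "((\<lambda>t. Fmu f c I 0 (x, l) + t *\<^sub>R r) has_derivative (\<lambda>t. F' (0, t *\<^sub>R b))) (at 0)"
    by (simp only:)
  moreover have "((\<lambda>t. Fmu f c I 0 (x, l) + t *\<^sub>R r) has_derivative (\<lambda>t. t *\<^sub>R r)) (at (0::real))"
    by (auto intro!: derivative_eq_intros)
  ultimately have "(\<lambda>t. F' (0, t *\<^sub>R b)) = (\<lambda>t. t *\<^sub>R r)" by (rule has_derivative_unique)
  from fun_cong[OF this, of 1] show ?thesis by (simp add: r_def)
qed

text \<open>For fixed multipliers the first block is the gradient of the Lagrangian in x, so its
  derivative is the Lagrangian Hessian; the second block is differentiated componentwise.\<close>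

lemma Fmu_derivative_primal:
  fixes f :: "real^'n \<Rightarrow> real" and c :: "real^'n \<Rightarrow> real^'m"
  assumes f: "Ck 2 f" and c: "\<And>i. Ck 2 (\<lambda>x. c x $ i)"
    and F': "(Fmu f c I 0 has_derivative F') (at (x, l))"
  shows "F' (a, 0) = (lag_hess f c x l *v a,
     \<chi> i. if i \<in> I then (row i (jac c x) \<bullet> a) * l $ i else row i (jac c x) \<bullet> a)"
proof -
  have "((\<lambda>y. (y, l)) has_derivative (\<lambda>h. (h, 0))) (at x)"
    by (auto intro!: derivative_eq_intros)
  from has_derivative_compose[OF this F']
  have FF: "((\<lambda>y. Fmu f c I 0 (y, l)) has_derivative (\<lambda>h. F' (h, 0))) (at x)" .
  have f1: "Ck (Suc 1) f" and c1: "Ck (Suc 1) (\<lambda>x. c x $ i)" for i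
    using f c[of i] by (simp_all add: numeral_2_eq_2)
  have dc: "(\<lambda>x. c x $ i) differentiable (at y)" for y i
    using Ck_imp_has_derivative[OF c1] differentiable_def by blast
  have grad_lag: "grad (\<lambda>y. f y - l \<bullet> c y) y = fst (Fmu f c I 0 (y, l))" for y
  proof -
    have "((\<lambda>y. f y - (\<Sum>i\<in>UNIV. l $ i * c y $ i)) has_derivative
       (\<lambda>h. frechet_derivative f (at y) h - (\<Sum>i\<in>UNIV. l $ i * frechet_derivative (\<lambda>x. c x $ i) (at y) h))) (at y)"
      by (intro has_derivative_diff has_derivative_sum has_derivative_mult_right
          Ck_imp_has_derivative[OF f1] Ck_imp_has_derivative[OF c1])
    from frechet_derivative_at[OF this]
    show ?thesis
      by (simp add: grad_def vec_eq_iff Fmu_def matrix_vector_mult_def transpose_def jac_def inner_vec_def mult.commute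
          fun_eq_iff)
  qed
  have "fst (F' (a, 0)) $ j = (lag_hess f c x l *v a) $ j" for j
  proof -
    have "((\<lambda>y. fst (Fmu f c I 0 (y, l)) $ j) has_derivative (\<lambda>h. fst (F' (h, 0)) $ j)) (at x)"
      by (intro bounded_linear.has_derivative[OF bounded_linear_vec_nth]
          bounded_linear.has_derivative[OF bounded_linear_fst] FF)
    then have d: "((\<lambda>y. grad (\<lambda>y. f y - l \<bullet> c y) y $ j) has_derivative (\<lambda>h. fst (F' (h, 0)) $ j)) (at x)"
      by (simp add: grad_lag)
    then have "(\<lambda>y. grad (\<lambda>y. f y - l \<bullet> c y) y $ j) differentiable (at x)"
      unfolding differentiable_def by blast
    from frechet_derivative_eq_grad[OF this, of a] fun_cong[OF frechet_derivative_at[OF d], of a]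
    have "fst (F' (a, 0)) $ j = grad (\<lambda>y. grad (\<lambda>y. f y - l \<bullet> c y) y $ j) x \<bullet> a"
      by (simp only:)
    then show ?thesis by (simp add: lag_hess_def hess_def matrix_vector_mult_def inner_vec_def)
  qed
  moreover have "snd (F' (a, 0)) $ i = (if i \<in> I then (row i (jac c x) \<bullet> a) * l $ i else row i (jac c x) \<bullet> a)" for i
  proof -
    have row: "row i (jac c x) \<bullet> a = frechet_derivative (\<lambda>x. c x $ i) (at x) a"
      by (simp add: frechet_derivative_eq_grad[OF dc] row_def jac_def vec_nth_inverse)
    have "((\<lambda>y. snd (Fmu f c I 0 (y, l)) $ i) has_derivative (\<lambda>h. snd (F' (h, 0)) $ i)) (at x)"
      by (intro bounded_linear.has_derivative[OF bounded_linear_vec_nth]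
          bounded_linear.has_derivative[OF bounded_linear_snd] FF)
    then have "((\<lambda>y. if i \<in> I then c y $ i * l $ i else c y $ i) has_derivative (\<lambda>h. snd (F' (h, 0)) $ i)) (at x)"
      by (simp add: Fmu_def cong: if_cong)
    moreover have "((\<lambda>y. if i \<in> I then c y $ i * l $ i else c y $ i) has_derivative
        (\<lambda>h. if i \<in> I then frechet_derivative (\<lambda>x. c x $ i) (at x) h * l $ i
             else frechet_derivative (\<lambda>x. c x $ i) (at x) h)) (at x)"
      using Ck_imp_has_derivative[OF c1] has_derivative_mult_left[OF Ck_imp_has_derivative[OF c1]]
      by (cases "i \<in> I") simp_all
    ultimately have "(\<lambda>h. snd (F' (h, 0)) $ i) = (\<lambda>h. if i \<in> I then frechet_derivative (\<lambda>x. c x $ i) (at x) h * l $ i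
             else frechet_derivative (\<lambda>x. c x $ i) (at x) h)"
      by (rule has_derivative_unique)
    from fun_cong[OF this, of a] show ?thesis by (simp add: row)
  qed
  ultimately show ?thesis by (simp add: prod_eq_iff vec_eq_iff)
qed

text \<open>Let (a, b) be in the kernel. The second block makes \<open>a\<close> orthogonal to all
  active gradients and \<open>b\<close> vanish on inactive indices. Pairing the first block with
  \<open>a\<close> then gives zero curvature, so a = 0 by second-order sufficiency, and b = 0 by
  LICQ.\<close>

lemma Fmu_derivative_inj:
  fixes f :: "real^'n \<Rightarrow> real" and c :: "real^'n \<Rightarrow> real^'m"
  assumes f: "Ck 2 f" and c: "\<And>i. Ck 2 (\<lambda>x. c x $ i)"
    and F': "(Fmu f c I 0 has_derivative F') (at (x, l))"
    and KKT: "is_KKT_mult f c I x l" and licq: "LICQ c I x" and sc: "strict_compl c I x l"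
    and ssosc: "SSOSC f c I x l"
  shows "inj F'"
proof -
  have lin: "linear F'" using F' by (rule has_derivative_linear)
  have "z = 0" if z: "F' z = 0" for z
  proof -
    obtain a b where ab: "z = (a, b)" by (cases z)
    have "F' z = F' (a, 0) + F' (0, b)" using linear_add[OF lin, of "(a, 0)" "(0, b)"] by (simp add: ab)
    with z have eqs: "lag_hess f c x l *v a - transpose (jac c x) *v b = 0"
      "\<And>i. (if i \<in> I then (row i (jac c x) \<bullet> a) * l $ i + c x $ i * b $ i else row i (jac c x) \<bullet> a) = 0"
      unfolding Fmu_derivative_primal[OF f c F'] Fmu_derivative_dual[OF F']
      by (auto simp: zero_prod_def vec_eq_iff split: if_splits)
    \<comment> \<open>For an active inequality c = 0 and l > 0 by strict complementarity, so only
      the gradient term survives.\<close>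
    have act: "row i (jac c x) \<bullet> a = 0" if "i \<in> active c I x" for i
      using that eqs(2)[of i] sc by (auto simp: active_def strict_compl_def split: if_splits)
    \<comment> \<open>For an inactive inequality complementarity gives l = 0, and c \<noteq> 0 can
      be cancelled.\<close>
    have inact: "b $ i = 0" if "i \<notin> active c I x" for i
    proof -
      have "i \<in> I" "c x $ i \<noteq> 0" using that by (auto simp: active_def)
      moreover from this have "l $ i = 0" using KKT by (auto simp: is_KKT_mult_def)
      ultimately show ?thesis using eqs(2)[of i] by simp
    qed
    have Atb: "transpose (jac c x) *v b = (\<Sum>i\<in>UNIV. b $ i *\<^sub>R row i (jac c x))"
      by (simp add: vec_eq_iff matrix_vector_mult_def transpose_def row_def mult.commute)
    \<comment> \<open>The Hessian term equals a linear combination of constraint gradients; in each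
      summand of its product with \<open>a\<close>, either the multiplier component or the gradient
      product is zero.\<close>
    have "a \<bullet> (lag_hess f c x l *v a) = (\<Sum>i\<in>UNIV. b $ i * (row i (jac c x) \<bullet> a))"
    proof -
      have "lag_hess f c x l *v a = (\<Sum>i\<in>UNIV. b $ i *\<^sub>R row i (jac c x))"
        using eqs(1) unfolding Atb by (simp only: right_minus_eq)
      then show ?thesis by (simp add: inner_sum_right inner_commute)
    qed
    also have "\<dots> = 0" using act inact by (intro sum.neutral) auto
    finally have aHa: "a \<bullet> (lag_hess f c x l *v a) = 0" .
    obtain \<omega> where "\<omega> > 0" "\<omega> * (norm a)\<^sup>2 \<le> a \<bullet> (lag_hess f c x l *v a)"
      using ssosc act unfolding SSOSC_def by blast
    then have "a = 0" using aHa by (simp add: mult_le_0_iff)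
    then have "(\<Sum>i\<in>UNIV. b $ i *\<^sub>R row i (jac c x)) = 0" using eqs(1) unfolding Atb by simp
    moreover have "(\<Sum>i\<in>UNIV. b $ i *\<^sub>R row i (jac c x)) = (\<Sum>i\<in>active c I x. b $ i *\<^sub>R row i (jac c x))"
      using inact by (intro sum.mono_neutral_right) auto
    ultimately have "\<forall>i\<in>active c I x. b $ i = 0" using licq unfolding LICQ_def by auto
    then have "b = 0" using inact by (auto simp: vec_eq_iff)
    with \<open>a = 0\<close> show ?thesis by (simp add: ab zero_prod_def)
  qed
  then show ?thesis using linear_injective_0[OF lin] by blast
qed

section \<open>Application to the interior-point method\<close>

lemma bigtheta_at_right_bounds:
  fixes f g :: "real \<Rightarrow> real"
  assumes "f \<in> \<Theta>[at_right 0](g)" and f: "\<And>t. t > 0 \<Longrightarrow> f t > 0" and g: "\<And>t. t > 0 \<Longrightarrow> g t > 0"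
  obtains c C where "c > 0" "\<forall>\<^sub>F t in at_right 0. c * g t \<le> f t \<and> f t \<le> C * g t"
proof -
  from assms(1) obtain C where C: "\<forall>\<^sub>F t in at_right 0. norm (f t) \<le> C * norm (g t)"
    by (auto simp: bigtheta_def elim: landau_o.bigE)
  from assms(1) obtain c where c: "c > 0" "\<forall>\<^sub>F t in at_right 0. norm (f t) \<ge> c * norm (g t)"
    by (auto simp: bigtheta_def elim: landau_omega.bigE)
  have "\<forall>\<^sub>F t::real in at_right 0. t > 0" by (rule eventually_at_right_less)
  with C c(2) have "\<forall>\<^sub>F t in at_right 0. c * g t \<le> f t \<and> f t \<le> C * g t"
    by eventually_elim (use f g in \<open>simp add: less_imp_le\<close>)
  with c(1) show ?thesis using that by blast
qed

theorem theorem1: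
  fixes f :: "real^'n \<Rightarrow> real" and c :: "real^'n \<Rightarrow> real^'m" and I :: "'m set"
    and d p :: nat and \<kappa> :: real and \<epsilon> \<phi> :: "real \<Rightarrow> real"
    and xs :: "real^'n" and ls :: "real^'m"
    and w :: "nat \<Rightarrow> (real^'n) \<times> (real^'m)" and \<mu> :: "nat \<Rightarrow> real" and \<sigma> :: "nat \<Rightarrow> nat"
  assumes d: "d \<ge> 3" and smooth_f: "Ck d f" and smooth_c: "\<forall>i. Ck d (\<lambda>x. c x $ i)"
    and KKT: "is_KKT_mult f c I xs ls"
    and licq: "LICQ c I xs"
    and sc: "strict_compl c I xs ls"
    and ssosc: "SSOSC f c I xs ls"
    and uniq: "\<forall>l. is_KKT_mult f c I xs l \<longrightarrow> l = ls"
    and p: "1 \<le> p" "p \<le> d - 2"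
    and kappa: "1 < \<kappa>" "\<kappa> < real p + 1"
    and eps_pos: "\<forall>t>0. \<epsilon> t > 0" and eps_Theta: "\<epsilon> \<in> \<Theta>[at_right 0](\<lambda>t. t)"
    and phi_pos: "\<forall>t>0. \<phi> t > 0" and phi_Theta: "\<phi> \<in> \<Theta>[at_right 0](\<lambda>t. t powr \<kappa>)"
    and iter: "epd_iterates f c I p \<epsilon> \<phi> w \<mu>"
    and mu_to_0: "\<mu> \<longlonglongrightarrow> 0"
    and subseq: "strict_mono \<sigma>" "(\<lambda>i. w (Suc (\<sigma> i))) \<longlonglongrightarrow> (xs, ls)"
  shows "w \<longlonglongrightarrow> (xs, ls) \<and>
    (\<forall>\<^sub>F k in sequentially.
        norm (Fmu f c I (\<mu> k) (wbar f c I p (\<mu> k) (w k))) \<le> \<epsilon> (\<mu> k) \<and>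
        w (Suc k) = wbar f c I p (\<mu> k) (w k)) \<and>
    (\<forall>b\<in>Basis. R_conv_order (\<lambda>k. w k \<bullet> b) ((xs, ls) \<bullet> b) \<kappa>) \<and>
    (\<forall>b\<in>Basis. traj_deriv0 f c I (xs, ls) \<bullet> b \<noteq> 0 \<longrightarrow>
        Q_conv_order (\<lambda>k. w k \<bullet> b) ((xs, ls) \<bullet> b) \<kappa>)"
proof -
  define F where "F = Fmu f c I 0"
  define e where "e = (rvec I 1 :: (real^'n) \<times> (real^'m))"
  have Fmu: "Fmu f c I m = (\<lambda>z. F z - m *\<^sub>R e)" for m
    unfolding F_def e_def by (rule ext) (rule Fmu_eq_shift)
  have rvec: "rvec I m = m *\<^sub>R e" for m
    unfolding e_def by (rule rvec_eq_scaleR)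
  have f_k: "Ck k f" if "k \<le> d" for k
    using smooth_f that unfolding Ck_iff_Ck_on by (rule Ck_on_mono)
  have c_k: "Ck k (\<lambda>x. c x $ i)" if "k \<le> d" for k i
    using smooth_c[rule_format, of i] that unfolding Ck_iff_Ck_on by (rule Ck_on_mono)
  \<comment> \<open>The data are of class C^d and F loses one derivative, so p \<le> d - 2 is just
    what gives class C^(p+1).\<close>
  have smooth_F: "Ck_on (Suc p) UNIV F"
    unfolding F_def using p d by (intro Ck_on_Fmu f_k c_k) auto
  have F_differentiable: "F differentiable (at z)" for z
    using smooth_F unfolding Ck_on.simps differentiable_def by blast
  then have F_deriv: "(F has_derivative frechet_derivative F (at (xs, ls))) (at (xs, ls))"
    using frechet_derivative_works by blast
  have inj: "inj (frechet_derivative F (at (xs, ls)))"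
    using d F_deriv unfolding F_def
    by (intro Fmu_derivative_inj[OF f_k c_k _ KKT licq sc ssosc]) auto
  obtain U V G where UV: "open U" "(xs, ls) \<in> U" "open V" "homeomorphism U V F G" "Ck_on (Suc p) V G"
    and bij: "\<And>z. z \<in> U \<Longrightarrow> bij (frechet_derivative F (at z))"
    using Ck_inverse_function[OF smooth_F F_deriv inj] by metis
  have F0: "F (xs, ls) = 0" unfolding F_def using KKT by (rule Fmu_KKT)
  interpret smooth_local_inverse F G U V "(xs, ls)" p
    using smooth_F UV F0 by unfold_locales
  obtain G' where G': "(G has_derivative G') (at 0)"
    using UV(5) zero_in_V unfolding Ck_on.simps by blast
  have pos: "\<mu> k > 0" for k
    using iter phi_pos by (induction k) (auto simp: epd_iterates_def)
  have mu_at_right: "filterlim \<mu> (at_right 0) sequentially"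
    using mu_to_0 pos by (auto intro!: filterlim_at_withinI)
  obtain c1 c2 where c12: "c1 > 0" "\<forall>\<^sub>F t in at_right 0. c1 * t \<le> \<epsilon> t \<and> \<epsilon> t \<le> c2 * t"
    using bigtheta_at_right_bounds[OF eps_Theta] eps_pos by auto
  obtain c3 c4 where c34: "c3 > 0" "\<forall>\<^sub>F t in at_right 0. c3 * t powr \<kappa> \<le> \<phi> t \<and> \<phi> t \<le> c4 * t powr \<kappa>"
    using bigtheta_at_right_bounds[OF phi_Theta] phi_pos by auto
  have eps_bounds: "\<forall>\<^sub>F k in sequentially. c1 * \<mu> k \<le> \<epsilon> (\<mu> k) \<and> \<epsilon> (\<mu> k) \<le> c2 * \<mu> k"
    using eventually_compose_filterlim[OF c12(2) mu_at_right] .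
  have mu_Suc: "\<mu> (Suc k) = \<phi> (\<mu> k)" for k using iter by (simp add: epd_iterates_def)
  have mu_bounds: "\<forall>\<^sub>F k in sequentially. c3 * \<mu> k powr \<kappa> \<le> \<mu> (Suc k) \<and> \<mu> (Suc k) \<le> c4 * \<mu> k powr \<kappa>"
    using eventually_compose_filterlim[OF c34(2) mu_at_right] by (simp add: mu_Suc)
  define wb where "wb k = wbar f c I p (\<mu> k) (w k)" for k
  \<comment> \<open>On a ball inside \<open>U\<close> the derivative of F is bijective, so there the
    first branch of \<open>wbar\<close> applies and the point is a genuine extrapolation.\<close>
  obtain \<delta> where \<delta>: "\<delta> > 0" "ball (xs, ls) \<delta> \<subseteq> U" using openE[OF UV(1,2)] .
  have wb: "wb k = extrap (\<lambda>z. F z - \<mu> k *\<^sub>R e) p (w k)" if "norm (w k - (xs, ls)) < \<delta>" for k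
  proof -
    have "w k \<in> ball (xs, ls) \<delta>" using that by (simp add: dist_norm norm_minus_commute)
    then have "w k \<in> U" using \<delta>(2) by blast
    then have "JF_invertible f c I (w k)"
      using bij F_differentiable by (simp add: JF_invertible_def F_def)
    then show ?thesis by (simp add: wb_def wbar_def Fmu)
  qed
  have test: "w (Suc k) = wb k" if "norm (F (wb k) - \<mu> k *\<^sub>R e) \<le> \<epsilon> (\<mu> k)" for k
    using iter that unfolding epd_iterates_def wb_def Fmu by (metis (no_types, lifting))
  \<comment> \<open>Whichever branch of the stopping test is taken, the accepted point satisfies
    it.\<close>
  have res: "norm (F (w (Suc k)) - \<mu> k *\<^sub>R e) \<le> \<epsilon> (\<mu> k)" for k
    using iter unfolding epd_iterates_def wb_def Fmu by (metis (no_types, lifting))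
  note concl = extrapolation_iterates[OF pos mu_to_0 kappa c12(1) c34(1) eps_bounds mu_bounds
      \<delta>(1) wb test res subseq G']
  \<comment> \<open>Identifying the trajectory derivative with \<open>G' e\<close> makes the
    condition for Q-convergence the nonvanishing of the limit of the error quotient in that
    component.\<close>
  have traj: "traj_deriv0 f c I (xs, ls) = G' e"
    unfolding traj_deriv0_def rvec F_def[symmetric]
  proof (rule the_equality)
    show "\<exists>G U. open U \<and> 0 \<in> U \<and> continuous_on U G \<and> G 0 = (xs, ls) \<and> (\<forall>r\<in>U. F (G r) = r) \<and>
        ((\<lambda>\<mu>. G (\<mu> *\<^sub>R e)) has_vector_derivative G' e) (at 0)"
      using open_V zero_in_V continuous_G G_zero F_G trajectory_has_vector_derivative[OF G'] by blast
  next
    fix v assume "\<exists>G U. open U \<and> 0 \<in> U \<and> continuous_on U G \<and> G 0 = (xs, ls) \<and> (\<forall>r\<in>U. F (G r) = r) \<and>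
        ((\<lambda>\<mu>. G (\<mu> *\<^sub>R e)) has_vector_derivative v) (at 0)"
    then show "v = G' e" using trajectory_derivative_unique[OF G'] by blast
  qed
  have mu_le: "\<forall>\<^sub>F k in sequentially. \<mu> (Suc k) \<le> c4 * \<mu> k powr \<kappa>"
    using mu_bounds by (rule eventually_mono) blast
  have comp_lim: "(\<lambda>k. w k \<bullet> b) \<longlonglongrightarrow> (xs, ls) \<bullet> b"
    "(\<lambda>k. (w (Suc k) \<bullet> b - (xs, ls) \<bullet> b) / \<mu> k) \<longlonglongrightarrow> G' e \<bullet> b" for b
    using tendsto_inner[OF concl(1) tendsto_const, of b] tendsto_inner[OF concl(3) tendsto_const, of b]
    by (simp_all add: inner_diff_left divide_inverse mult.commute)
  have "R_conv_order (\<lambda>k. w k \<bullet> b) ((xs, ls) \<bullet> b) \<kappa>" for b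
    by (rule R_conv_orderI[OF pos mu_to_0 kappa(1) mu_le comp_lim])
  moreover have "Q_conv_order (\<lambda>k. w k \<bullet> b) ((xs, ls) \<bullet> b) \<kappa>" if "G' e \<bullet> b \<noteq> 0" for b
    using kappa(1) by (intro Q_conv_orderI[OF pos _ mu_le comp_lim that]) simp
  ultimately show ?thesis
    using concl(1,2) unfolding traj wb_def Fmu by blast
qed

end
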